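(* Let $p\in(0,1)$ be fixed (independent of $n$). For almost all graphs $G$ in the Erdős–Rényi model $G_{n,p}$, the energy of the ABC-matrix $ABC(G)$ satisfies $$\mathscr{E}(ABC(G))=(1+o(1))\cdot\frac{8\sqrt2}{3\pi}\sqrt{1-p}\cdot n.$$
   Context: $G_{n,p}$ is the model of random simple graphs on vertex set $\{1,\dots,n\}$ in which each edge is present independently with probability $p$; $d_i$ is the degree of vertex $i$ in $G=(V,E)$. $ABC(G)$ is the $n\times n$ matrix with $(i,j)$-entry $\frac{\sqrt{d_i+d_j-2}}{\sqrt{d_id_j}}$ if $ij\in E$ and $0$ otherwise. The energy of a real symmetric matrix $A$ with eigenvalues $\lambda_1,\dots,\lambda_n$ is $\mathscr{E}(A)=\sum_{i=1}^n|\lambda_i|$. "Almost all" means with probability tending to $1$ as $n\to\infty$; thus "for almost all graphs, $\mathscr{E}=(1+o(1))g(n)$" means that for every $\varepsilon>0$, $\Pr(|\mathscr{E}/g(n)-1|>\varepsilon)\to0$ as $n\to\infty$. *)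

theory Defs
  imports "HOL-Probability.Product_PMF" "Jordan_Normal_Form.Spectral_Radius"
begin

text \<open>A simple graph on the vertex set \<open>{1..n}\<close> is given by its edge set, a subset of
  \<open>all_edges n\<close>.\<close>

definition all_edges :: "nat \<Rightarrow> nat set set" where
  "all_edges n = {e. e \<subseteq> {1..n} \<and> card e = 2}"

definition gnp_pmf :: "nat \<Rightarrow> real \<Rightarrow> nat set set pmf" where
  "gnp_pmf n p = map_pmf (\<lambda>f. {e \<in> all_edges n. f e})
     (Pi_pmf (all_edges n) False (\<lambda>_. bernoulli_pmf p))"

definition vertex_degree :: "nat set set \<Rightarrow> nat \<Rightarrow> nat" where
  "vertex_degree E v = card {e \<in> E. v \<in> e}"

text \<open>Matrix indices start at 0, so index \<open>i\<close> belongs to the vertex \<open>i + 1\<close>. The subtraction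
  takes place in the reals; it is nonnegative whenever the two vertices are adjacent.\<close>

definition ABC_matrix :: "nat \<Rightarrow> nat set set \<Rightarrow> real mat" where
  "ABC_matrix n E = Matrix.mat n n (\<lambda>(i, j).
     if {i + 1, j + 1} \<in> E
     then sqrt (real (vertex_degree E (i + 1)) + real (vertex_degree E (j + 1)) - 2) /
          sqrt (real (vertex_degree E (i + 1)) * real (vertex_degree E (j + 1)))
     else 0)"

text \<open>The eigenvalues of a matrix, with algebraic multiplicity. A real symmetric matrix of
  dimension \<open>n\<close> has exactly \<open>n\<close> of them, see \<open>size_eigenvalues_symmetric\<close> below; for other
  real matrices the multiset omits the non-real eigenvalues.\<close>

definition eigenvalues_mset :: "real mat \<Rightarrow> real multiset" where
  "eigenvalues_mset A = proots (char_poly A)"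

definition matrix_energy :: "real mat \<Rightarrow> real" where
  "matrix_energy A = (\<Sum>x \<in># eigenvalues_mset A. \<bar>x\<bar>)"

lemma ABC_matrix_carrier: "ABC_matrix n E \<in> carrier_mat n n"
  by (simp add: ABC_matrix_def)

lemma transpose_ABC_matrix: "transpose_mat (ABC_matrix n E) = ABC_matrix n E"
  by (rule eq_matI) (auto simp: ABC_matrix_def insert_commute add.commute mult.commute)

lemma eigenvalue_symmetric_real:
  fixes A :: "real mat" and k :: complex
  assumes A: "A \<in> carrier_mat n n" and sym: "transpose_mat A = A"
    and k: "eigenvalue (map_mat complex_of_real A) k"
  shows "k \<in> \<real>"
proof -
  let ?B = "map_mat complex_of_real A"
  have B: "?B \<in> carrier_mat n n" using A by simp
  obtain v where v: "v \<in> carrier_vec n" "v \<noteq> 0\<^sub>v n" "?B *\<^sub>v v = k \<cdot>\<^sub>v v"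
    using k B by (auto simp: eigenvalue_def eigenvector_def)
  have entry: "A $$ (i, j) = A $$ (j, i)" if "i < n" "j < n" for i j
    using A sym that by (metis carrier_matD index_transpose_mat(1))
  have row: "(\<Sum>j<n. complex_of_real (A $$ (i, j)) * v $ j) = k * v $ i" if "i < n" for i
  proof -
    have "(?B *\<^sub>v v) $ i = (\<Sum>j<n. complex_of_real (A $$ (i, j)) * v $ j)"
      using A v(1) that by (auto simp: scalar_prod_def lessThan_atLeast0 intro!: sum.cong)
    thus ?thesis using v that by simp
  qed
  define S where "S = (\<Sum>i<n. \<Sum>j<n. cnj (v $ i) * (complex_of_real (A $$ (i, j)) * v $ j))"
  define N where "N = (\<Sum>i<n. (cmod (v $ i))\<^sup>2)"
  have S: "S = k * of_real N"
  proof -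
    have "S = (\<Sum>i<n. cnj (v $ i) * (k * v $ i))"
      unfolding S_def by (intro sum.cong refl) (simp add: row flip: sum_distrib_left)
    thus ?thesis
      by (simp add: N_def sum_distrib_left mult_ac complex_norm_square del: of_real_power)
  qed
  have "cnj S = (\<Sum>i<n. \<Sum>j<n. v $ i * (complex_of_real (A $$ (i, j)) * cnj (v $ j)))"
    by (simp add: S_def)
  also have "\<dots> = (\<Sum>j<n. \<Sum>i<n. v $ i * (complex_of_real (A $$ (i, j)) * cnj (v $ j)))"
    by (rule sum.swap)
  also have "\<dots> = S"
    unfolding S_def by (intro sum.cong refl) (simp add: entry mult_ac)
  finally have "cnj k * of_real N = k * of_real N" by (simp add: S)
  moreover have "N \<noteq> 0"
  proof
    assume "N = 0"
    hence "\<forall>i<n. v $ i = 0" by (simp add: N_def sum_nonneg_eq_0_iff)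
    hence "v = 0\<^sub>v n" using v(1) by (intro eq_vecI) auto
    with v(2) show False by simp
  qed
  ultimately show ?thesis by (simp add: Reals_cnj_iff)
qed

lemma size_eigenvalues_symmetric:
  fixes A :: "real mat"
  assumes A: "A \<in> carrier_mat n n" and sym: "transpose_mat A = A"
  shows "size (eigenvalues_mset A) = n"
proof -
  interpret c: map_poly_inj_idom_hom complex_of_real ..
  let ?B = "map_mat complex_of_real A"
  have B: "?B \<in> carrier_mat n n" using A by simp
  obtain as where as: "char_poly ?B = (\<Prod>a\<leftarrow>as. [:- a, 1:])" "length as = n"
    using char_poly_factorized[OF B] by blast
  have real: "a \<in> \<real>" if "a \<in> set as" for a
  proof -
    have "poly (char_poly ?B) a = 0"
      using that by (auto simp: as(1) poly_prod_list prod_list_zero_iff)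
    hence "eigenvalue ?B a" using B eigenvalue_root_char_poly by blast
    thus ?thesis by (rule eigenvalue_symmetric_real[OF A sym])
  qed
  have "char_poly ?B = map_poly complex_of_real (\<Prod>a\<leftarrow>map Re as. [:- a, 1:])"
    unfolding as(1) c.hom_prod_list map_map
    by (intro arg_cong[where f = prod_list] map_cong refl) (auto dest: real simp: complex_eq_iff complex_is_Real_iff)
  moreover have "char_poly ?B = map_poly complex_of_real (char_poly A)"
    by (rule of_real_hom.char_poly_hom[OF A])
  ultimately have "char_poly A = (\<Prod>a\<leftarrow>map Re as. [:- a, 1:])" by simp
  moreover have "size (proots (\<Prod>a\<leftarrow>xs. [:- a, 1:])) = length xs" for xs :: "real list"
  proof (induction xs)
    case (Cons x xs)
    have "(\<Prod>a\<leftarrow>xs. [:- a, 1:]) \<noteq> 0" by (auto simp: prod_list_zero_iff)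
    hence "proots ([:- x, 1:] * (\<Prod>a\<leftarrow>xs. [:- a, 1:]))
        = proots [:- x, 1:] + proots (\<Prod>a\<leftarrow>xs. [:- a, 1:])"
      by (intro proots_mult) auto
    with Cons show ?case by simp
  qed simp
  ultimately show ?thesis using as(2) by (simp add: eigenvalues_mset_def del: map_map)
qed

end

theory Submission
  imports Defs
begin

text \<open>
  Why the theorem holds. All degrees of \<open>G\<^sub>n\<^sub>,\<^sub>p\<close> are close to \<open>n p\<close>, so the ABC-matrix is close to
  the adjacency matrix multiplied by \<open>a = sqrt (2 / (n p))\<close>; the Frobenius norm of the difference is of
  order \<open>n\<close> to the power \<open>1 / 4\<close> in expectation (lemma \<open>E_frobenius_diff\<close>), whereas that of the matrices
  is of order \<open>sqrt n\<close>. Subtracting the rank-one matrix with all entries \<open>a p\<close> from the scaled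
  adjacency matrix leaves a Wigner matrix: the entries above the diagonal are independent and
  centered with variance \<open>v / n\<close>, where \<open>v = 2 (1 - p)\<close>.
  Its spectrum follows the semicircle law of variance \<open>v\<close>, whose first absolute moment is
  \<open>8 sqrt v / (3 pi)\<close>. This is the constant of the theorem.

  The argument does not compute moments. It follows the trace of the resolvent \<open>(A - i t)\<inverse>\<close> for
  real \<open>t > 0\<close>, which is convenient for three reasons.

  It determines the energy: \<open>\<bar>x\<bar>\<close> is \<open>2 / pi\<close> times the integral of \<open>x\<^sup>2 / (x\<^sup>2 + t\<^sup>2)\<close> over \<open>t > 0\<close>, and
  the sum of \<open>t / (x\<^sup>2 + t\<^sup>2)\<close> over the eigenvalues \<open>x\<close> is the imaginary part of that trace
  (\<open>trace_resolvent_eigenvalues\<close>). Riemann sums turn this into a statement about finitely many \<open>t\<close>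
  (\<open>abs_riemann_sum\<close>, \<open>semicircle_riemann_sum\<close>, \<open>energy_approximation\<close>).

  It is insensitive to perturbations: a rank-one change moves it by at most \<open>1 / t\<close>
  (\<open>cmod_trace_rank_one_diff\<close>), and a change of Frobenius norm \<open>d\<close> moves it by at most
  \<open>d sqrt n / t\<^sup>2\<close> (\<open>cmod_trace_frobenius_diff\<close>).

  It satisfies a self-consistent equation: by the Schur complement, the \<open>i\<close>-th diagonal entry of the
  resolvent is \<open>1 / (X\<^sub>i\<^sub>i - i t - q\<^sub>i)\<close>, where \<open>q\<^sub>i\<close> is a quadratic form in the \<open>i\<close>-th row whose coefficients
  do not depend on that row. Such a form concentrates (\<open>E_quadratic_form_sq\<close>) around \<open>v s\<close>, where \<open>s\<close> is
  the normalized trace, so \<open>s\<close> nearly solves \<open>s = - 1 / (i t + v s)\<close>. This quadratic equation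
  has one root in the upper half plane, and \<open>s\<close> is close to it (\<open>self_consistent_stability\<close>). That root
  is the Stieltjes transform of the semicircle law.
\<close>

section \<open>Resolvents of real symmetric matrices on the imaginary axis\<close>

text \<open>The matrix \<open>X\<close> is a function on an index set \<open>S\<close> and \<open>G\<close> is a right inverse of \<open>X - i t\<close> on \<open>S\<close>.
  With index sets in place of dimensions, deleting a row and the corresponding column is the removal
  of one element of \<open>S\<close> and needs no reindexing.\<close>

definition is_resolvent :: "'a set \<Rightarrow> ('a \<Rightarrow> 'a \<Rightarrow> real) \<Rightarrow> real \<Rightarrow> ('a \<Rightarrow> 'a \<Rightarrow> complex) \<Rightarrow> bool" where
  "is_resolvent S X t G \<longleftrightarrow> (\<forall>i\<in>S. \<forall>k\<in>S.
     (\<Sum>j\<in>S. of_real (X i j) * G j k) = \<i> * of_real t * G i k + of_bool (i = k))"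

text \<open>Pair \<open>(X - i t) w = b\<close> with \<open>w\<close>: the quadratic form of the symmetric matrix \<open>X\<close> is real, so the
  imaginary part sees only the shift. Every bound on resolvents below comes from this identity.\<close>

lemma shifted_system_dissipation:
  fixes X :: "'a \<Rightarrow> 'a \<Rightarrow> real" and w b :: "'a \<Rightarrow> complex"
  assumes fin: "finite S" and sym: "\<And>i j. X i j = X j i"
    and w: "\<And>i. i \<in> S \<Longrightarrow> (\<Sum>j\<in>S. of_real (X i j) * w j) = \<i> * of_real t * w i + b i"
  shows "t * (\<Sum>i\<in>S. (cmod (w i))\<^sup>2) = Im (\<Sum>i\<in>S. w i * cnj (b i))"
proof -
  define Q where "Q = (\<Sum>i\<in>S. \<Sum>j\<in>S. cnj (w i) * (of_real (X i j) * w j))"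
  have "cnj Q = (\<Sum>i\<in>S. \<Sum>j\<in>S. w i * (of_real (X i j) * cnj (w j)))"
    by (simp add: Q_def)
  also have "\<dots> = (\<Sum>j\<in>S. \<Sum>i\<in>S. w i * (of_real (X i j) * cnj (w j)))"
    by (rule sum.swap)
  also have "\<dots> = Q"
    unfolding Q_def by (intro sum.cong refl) (metis mult.assoc mult.commute sym)
  finally have Im_Q: "Im Q = 0" by (metis Reals_cnj_iff complex_is_Real_iff)
  have "Q = (\<Sum>i\<in>S. cnj (w i) * (\<i> * of_real t * w i + b i))"
    unfolding Q_def by (intro sum.cong refl) (simp add: w flip: sum_distrib_left)
  hence "Im Q = (\<Sum>i\<in>S. Im (cnj (w i) * (\<i> * of_real t * w i + b i)))"
    by (simp only: Im_sum)
  also have "\<dots> = (\<Sum>i\<in>S. t * (cmod (w i))\<^sup>2 - Im (w i * cnj (b i)))"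
    unfolding cmod_power2 by (intro sum.cong refl) (simp add: algebra_simps power2_eq_square)
  finally have "Im Q = (\<Sum>i\<in>S. t * (cmod (w i))\<^sup>2 - Im (w i * cnj (b i)))" .
  with Im_Q show ?thesis
    by (simp only: sum_subtractf sum_distrib_left Im_sum)
qed

text \<open>In other words, the inverse of \<open>X - i t\<close> has operator norm at most \<open>1 / t\<close>.\<close>

lemma shifted_system_bound:
  fixes X :: "'a \<Rightarrow> 'a \<Rightarrow> real" and w b :: "'a \<Rightarrow> complex"
  assumes fin: "finite S" and sym: "\<And>i j. X i j = X j i" and t: "t > 0"
    and w: "\<And>i. i \<in> S \<Longrightarrow> (\<Sum>j\<in>S. of_real (X i j) * w j) = \<i> * of_real t * w i + b i"
  shows "(\<Sum>i\<in>S. (cmod (w i))\<^sup>2) \<le> (\<Sum>i\<in>S. (cmod (b i))\<^sup>2) / t\<^sup>2"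
proof -
  have "Im (w i * cnj (b i)) \<le> t / 2 * (cmod (w i))\<^sup>2 + (cmod (b i))\<^sup>2 / (2 * t)" for i
  proof -
    have "Im (w i * cnj (b i)) \<le> cmod (w i) * cmod (b i)"
      using abs_Im_le_cmod[of "w i * cnj (b i)"] by (simp add: norm_mult)
    also have "\<dots> \<le> t / 2 * (cmod (w i))\<^sup>2 + (cmod (b i))\<^sup>2 / (2 * t)"
      using zero_le_power2[of "t * cmod (w i) - cmod (b i)"] t
      by (simp add: field_simps power2_eq_square)
    finally show ?thesis .
  qed
  hence "Im (\<Sum>i\<in>S. w i * cnj (b i))
      \<le> (\<Sum>i\<in>S. t / 2 * (cmod (w i))\<^sup>2 + (cmod (b i))\<^sup>2 / (2 * t))"
    unfolding Im_sum by (intro sum_mono)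
  hence "t * (\<Sum>i\<in>S. (cmod (w i))\<^sup>2)
      \<le> t / 2 * (\<Sum>i\<in>S. (cmod (w i))\<^sup>2) + (\<Sum>i\<in>S. (cmod (b i))\<^sup>2) / (2 * t)"
    using shifted_system_dissipation[where X = X and t = t and w = w and b = b, OF fin sym w]
    by (simp only: sum.distrib sum_distrib_left sum_divide_distrib)
  thus ?thesis using t by (simp add: field_simps power2_eq_square)
qed

text \<open>The second resolvent identity \<open>H\<^sup>T (Y - X) G = G - H\<^sup>T\<close>: evaluate \<open>H\<^sup>T Y G\<close> and \<open>H\<^sup>T X G\<close> by means of the
  two defining equations. The transpose costs nothing and makes the case \<open>X = Y\<close> informative: it says
  that the resolvent is unique and symmetric.\<close>

lemma resolvent_identity:
  assumes fin: "finite S" and symX: "\<And>i j. X i j = X j i"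
    and G: "is_resolvent S X t G" and H: "is_resolvent S Y t H"
    and symY: "\<And>i j. Y i j = Y j i" and ab: "a \<in> S" "b \<in> S"
  shows "(\<Sum>i\<in>S. \<Sum>j\<in>S. H i a * of_real (Y i j - X i j) * G j b) = G a b - H b a"
proof -
  have 1: "(\<Sum>i\<in>S. \<Sum>j\<in>S. H i a * of_real (X i j) * G j b) = 
      (\<Sum>i\<in>S. H i a * (\<i> * of_real t * G i b + of_bool (i = b)))"
    using G ab by (intro sum.cong refl) (simp add: is_resolvent_def mult.assoc flip: sum_distrib_left)
  have "(\<Sum>i\<in>S. \<Sum>j\<in>S. H i a * of_real (Y i j) * G j b) = 
     (\<Sum>j\<in>S. \<Sum>i\<in>S. H i a * of_real (Y i j) * G j b)" by (rule sum.swap)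
  also have "\<dots> = (\<Sum>j\<in>S. (\<Sum>i\<in>S. of_real (Y j i) * H i a) * G j b)"
    unfolding sum_distrib_right by (intro sum.cong refl) (metis mult.commute symY)
  also have "\<dots> = (\<Sum>j\<in>S. (\<i> * of_real t * H j a + of_bool (j = a)) * G j b)"
    using H ab by (auto simp: is_resolvent_def intro!: sum.cong)
  finally have 2: "(\<Sum>i\<in>S. \<Sum>j\<in>S. H i a * of_real (Y i j) * G j b) = \<dots>" .
  have "(\<Sum>i\<in>S. \<Sum>j\<in>S. H i a * of_real (Y i j - X i j) * G j b) = 
     (\<Sum>j\<in>S. (\<i> * of_real t * H j a + of_bool (j = a)) * G j b) - 
     (\<Sum>i\<in>S. H i a * (\<i> * of_real t * G i b + of_bool (i = b)))"
    unfolding 1[symmetric] 2[symmetric] by (simp add: sum_subtractf algebra_simps)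
  also have "\<dots> = (\<Sum>j\<in>S. of_bool (j = a) * G j b) - (\<Sum>i\<in>S. of_bool (i = b) * H i a)"
    by (simp add: sum.distrib algebra_simps)
  also have "\<dots> = G a b - H b a"
    using fin ab by (simp add: of_bool_def if_distrib[where f="\<lambda>x. x * _"] cong: if_cong)
  finally show ?thesis .
qed

lemma resolvent_transpose_unique:
  assumes "finite S" "\<And>i j. X i j = X j i" "is_resolvent S X t G" "is_resolvent S X t H"
    "a \<in> S" "b \<in> S"
  shows "G a b = H b a"
  using resolvent_identity[OF assms(1,2,3,4,2,5,6)] by simp

lemma resolvent_unique:
  assumes "finite S" "\<And>i j. X i j = X j i" "is_resolvent S X t G" "is_resolvent S X t H"
    "a \<in> S" "b \<in> S"
  shows "G a b = H a b"
  using resolvent_transpose_unique[OF assms] resolvent_transpose_unique[OF assms(1,2,4,4,6,5)] by simp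

lemma resolvent_column_norm:
  assumes "finite S" "\<And>i j. X i j = X j i" "t > 0" "is_resolvent S X t G" "k \<in> S"
  shows "(\<Sum>i\<in>S. (cmod (G i k))\<^sup>2) \<le> 1 / t\<^sup>2"
  using shifted_system_bound[where X = X and w = "\<lambda>i. G i k" and b = "\<lambda>i. of_bool (i = k)", OF assms(1-3)] assms
  by (auto simp: is_resolvent_def of_bool_def if_distrib[where f="\<lambda>x. (cmod x)\<^sup>2"] cong: if_cong)

lemma resolvent_diagonal_Im:
  assumes "finite S" "\<And>i j. X i j = X j i" "t > 0" "is_resolvent S X t G" "k \<in> S"
  shows "t * (\<Sum>i\<in>S. (cmod (G i k))\<^sup>2) = Im (G k k)"
  using shifted_system_dissipation[where X = X and t = t and w = "\<lambda>i. G i k" and b = "\<lambda>i. of_bool (i = k)", OF assms(1-2)] assms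
  by (auto simp: is_resolvent_def of_bool_def if_distrib[where f="\<lambda>x. _ * cnj x"] cong: if_cong)

lemma cmod_resolvent_diagonal:
  assumes "finite S" "\<And>i j. X i j = X j i" "t > 0" "is_resolvent S X t G" "k \<in> S"
  shows "cmod (G k k) \<le> 1 / t"
proof -
  have "(cmod (G k k))\<^sup>2 \<le> (\<Sum>i\<in>S. (cmod (G i k))\<^sup>2)"
    using assms by (intro member_le_sum) auto
  also have "\<dots> \<le> 1 / t\<^sup>2" by (rule resolvent_column_norm[OF assms])
  finally show ?thesis using assms(3)
    by (metis less_eq_real_def power2_le_imp_le power_one_over zero_le_divide_1_iff)
qed

text \<open>Solutions of \<open>(X - i t) w = x\<close> for an arbitrary right-hand side, by linearity from the columns of
  the resolvent.\<close>

lemma resolvent_apply: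
  assumes fin: "finite S" and G: "is_resolvent S X t G" and l: "l \<in> S"
  shows "(\<Sum>j\<in>S. of_real (X l j) * (\<Sum>k\<in>S. G j k * x k)) = \<i> * of_real t * (\<Sum>k\<in>S. G l k * x k) + x l"
proof -
  have "(\<Sum>j\<in>S. of_real (X l j) * (\<Sum>k\<in>S. G j k * x k)) = 
      (\<Sum>k\<in>S. (\<Sum>j\<in>S. of_real (X l j) * G j k) * x k)"
    unfolding sum_distrib_left sum_distrib_right by (subst sum.swap) (simp add: mult.assoc)
  also have "\<dots> = (\<Sum>k\<in>S. (\<i> * of_real t * G l k + of_bool (l = k)) * x k)"
    using G l by (intro sum.cong) (auto simp: is_resolvent_def)
  also have "\<dots> = \<i> * of_real t * (\<Sum>k\<in>S. G l k * x k) + (\<Sum>k\<in>S. of_bool (k = l) * x k)"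
    by (simp add: distrib_right sum.distrib sum_distrib_left mult.assoc eq_commute[of l])
  also have "(\<Sum>k\<in>S. of_bool (k = l) * x k) = x l"
    using fin l by (simp add: of_bool_def if_distrib[where f="\<lambda>x. x * _"] cong: if_cong)
  finally show ?thesis .
qed

text \<open>The Schur complement formula. Given the resolvent \<open>H\<close> on \<open>S\<close>, the resolvent \<open>G\<close> on \<open>insert i S\<close>
  is \<open>H\<close> plus a rank-one term: \<open>w = H x\<close> for the column \<open>x\<close> of the new index, \<open>q = x\<^sup>T H x\<close>, and \<open>D\<close> is the
  Schur complement of the block \<open>S\<close>.\<close>

locale resolvent_extension =
  fixes S :: "'a set" and X :: "'a \<Rightarrow> 'a \<Rightarrow> real" and t :: real and H :: "'a \<Rightarrow> 'a \<Rightarrow> complex" and i :: 'a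
  assumes fin: "finite S" and sym: "\<And>i j. X i j = X j i" and t: "t > 0"
    and H: "is_resolvent S X t H" and i: "i \<notin> S"
begin

definition w where "w j = (\<Sum>k\<in>S. H j k * of_real (X k i))"
definition q where "q = (\<Sum>j\<in>S. of_real (X i j) * w j)"
definition D where "D = of_real (X i i) - \<i> * of_real t - q"
definition G where "G j k = (if j = i then if k = i then 1 / D else - w k / D
   else if k = i then - w j / D else H j k + w j * w k / D)"

lemma w_eq: "l \<in> S \<Longrightarrow> (\<Sum>j\<in>S. of_real (X l j) * w j) = \<i> * of_real t * w l + of_real (X l i)"
  unfolding w_def by (rule resolvent_apply[OF fin H])

lemma Im_q: "Im q = t * (\<Sum>j\<in>S. (cmod (w j))\<^sup>2)"
  using shifted_system_dissipation[OF fin sym w_eq]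
  by (simp add: q_def sym[of i] mult.commute)

lemma Im_D: "Im D = - (t * (1 + (\<Sum>j\<in>S. (cmod (w j))\<^sup>2)))"
  by (simp add: D_def Im_q algebra_simps)

text \<open>The modulus of \<open>D\<close> grows with \<open>\<parallel>w\<parallel>\<^sup>2\<close>. This is exactly what bounds the correction \<open>w w\<^sup>T / D\<close>
  whatever the size of the new row.\<close>

lemma cmod_D: "t * (1 + (\<Sum>j\<in>S. (cmod (w j))\<^sup>2)) \<le> cmod D"
  using abs_Im_le_cmod[of D] t unfolding Im_D by (simp add: abs_mult sum_nonneg abs_of_nonneg add_nonneg_nonneg)

lemma cmod_D_ge: "t \<le> cmod D"
proof -
  have "t * 1 \<le> t * (1 + (\<Sum>j\<in>S. (cmod (w j))\<^sup>2))"
    using t by (intro mult_left_mono) (auto intro: sum_nonneg)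
  thus ?thesis using cmod_D by simp
qed

lemma D_nz: "D \<noteq> 0"
  using cmod_D_ge t by auto

lemma is_resolvent_insert: "is_resolvent (insert i S) X t G"
  unfolding is_resolvent_def
proof (intro ballI)
  have q: "of_real (X i i) - q = D + \<i> * of_real t" by (simp add: D_def)
  have wsym: "(\<Sum>j\<in>S. of_real (X i j) * H j k) = w k" if "k \<in> S" for k
    unfolding w_def using resolvent_transpose_unique[OF fin sym H H] that
    by (intro sum.cong) (auto simp: sym[of i] mult.commute)
  fix l k assume l: "l \<in> insert i S" and k: "k \<in> insert i S"
  have expand: "(\<Sum>j\<in>insert i S. of_real (X l j) * G j k) = 
      of_real (X l i) * G i k + (\<Sum>j\<in>S. of_real (X l j) * G j k)"
    using fin i by simp
  have col_i: "(\<Sum>j\<in>S. of_real (X l j) * G j i) = - (\<Sum>j\<in>S. of_real (X l j) * w j) / D"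
    using i by (auto simp: G_def sum_divide_distrib sum_negf[symmetric] intro!: sum.cong)
  have col_k: "(\<Sum>j\<in>S. of_real (X l j) * G j k) = (\<Sum>j\<in>S. of_real (X l j) * H j k) + 
      (\<Sum>j\<in>S. of_real (X l j) * w j) * w k / D" if "k \<in> S"
  proof -
    have "(\<Sum>j\<in>S. of_real (X l j) * G j k) = (\<Sum>j\<in>S. of_real (X l j) * H j k + of_real (X l j) * w j * w k / D)"
      using i that by (intro sum.cong) (auto simp: G_def algebra_simps)
    thus ?thesis by (simp add: sum.distrib sum_distrib_right sum_divide_distrib)
  qed
  show "(\<Sum>j\<in>insert i S. of_real (X l j) * G j k) = \<i> * of_real t * G l k + of_bool (l = k)"
  proof (cases "k = i")
    case True
    show ?thesis
    proof (cases "l = i")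
      case True
      have "(\<Sum>j\<in>insert i S. of_real (X l j) * G j k) = (of_real (X i i) - q) / D"
        using \<open>k = i\<close> True expand col_i by (simp add: q_def G_def diff_divide_distrib)
      also have "\<dots> = \<i> * of_real t / D + 1" unfolding q using D_nz by (simp add: add_divide_distrib)
      finally show ?thesis using \<open>k = i\<close> True by (simp add: G_def)
    next
      case False
      hence "l \<in> S" using l by simp
      thus ?thesis using \<open>k = i\<close> False expand col_i w_eq by (simp add: G_def add_divide_distrib diff_divide_distrib)
    qed
  next
    case False
    hence kS: "k \<in> S" using k by simp
    show ?thesis
    proof (cases "l = i")
      case True
      have "(\<Sum>j\<in>insert i S. of_real (X l j) * G j k) = w k - (of_real (X i i) - q) * w k / D"
        using kS False True expand col_k[OF kS] wsym[OF kS] by (simp add: q_def G_def diff_divide_distrib left_diff_distrib)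
      also have "\<dots> = \<i> * of_real t * (- w k / D)" unfolding q using D_nz by (simp add: field_simps)
      finally show ?thesis using False True by (simp add: G_def)
    next
      case lF: False
      hence lS: "l \<in> S" using l by simp
      have "(\<Sum>j\<in>S. of_real (X l j) * H j k) = \<i> * of_real t * H l k + of_bool (l = k)"
        using H lS kS by (auto simp: is_resolvent_def)
      thus ?thesis using False lF expand col_k[OF kS] w_eq[OF lS]
        by (simp add: G_def algebra_simps add_divide_distrib diff_divide_distrib)
    qed
  qed
qed

lemma cmod_trace_diff: "cmod ((\<Sum>j\<in>insert i S. G j j) - (\<Sum>j\<in>S. H j j)) \<le> 1 / t"
proof -
  have "(\<Sum>j\<in>S. G j j) = (\<Sum>j\<in>S. H j j + w j * w j / D)"
    using i by (intro sum.cong) (auto simp: G_def)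
  hence "(\<Sum>j\<in>insert i S. G j j) - (\<Sum>j\<in>S. H j j) = (1 + (\<Sum>j\<in>S. w j * w j)) / D"
    using fin i by (simp add: sum.distrib add_divide_distrib sum_divide_distrib) (simp add: G_def)
  moreover have "cmod (1 + (\<Sum>j\<in>S. w j * w j)) \<le> 1 + (\<Sum>j\<in>S. (cmod (w j))\<^sup>2)"
    by (rule order_trans[OF norm_triangle_ineq])
      (auto intro!: sum_norm_le simp: norm_mult power2_eq_square)
  moreover have "\<dots> / cmod D \<le> 1 / t"
    using cmod_D t D_nz by (simp add: field_simps)
  ultimately show ?thesis
    by (smt (verit) divide_right_mono norm_divide norm_ge_zero)
qed

end

text \<open>The Schur complement formula builds the resolvent one index at a time.\<close>

lemma ex_resolvent:
  assumes fin: "finite S" and sym: "\<And>i j. X i j = X j i" and t: "t > 0"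
  shows "\<exists>G. is_resolvent S X t G"
  using fin
proof (induction S)
  case empty
  show ?case by (simp add: is_resolvent_def)
next
  case (insert i S)
  then obtain H where "is_resolvent S X t H" by blast
  then interpret resolvent_extension S X t H i
    using insert sym t by unfold_locales auto
  show ?case using is_resolvent_insert by blast
qed

definition resolvent :: "'a set \<Rightarrow> ('a \<Rightarrow> 'a \<Rightarrow> real) \<Rightarrow> real \<Rightarrow> 'a \<Rightarrow> 'a \<Rightarrow> complex" where
  "resolvent S X t = (SOME G. is_resolvent S X t G)"

lemma is_resolvent_resolvent:
  assumes "finite S" "\<And>i j. X i j = X j i" "t > 0"
  shows "is_resolvent S X t (resolvent S X t)"
  unfolding resolvent_def using ex_resolvent[OF assms] by (rule someI_ex)

text \<open>The resolvent on \<open>S\<close> does not depend on entries of \<open>X\<close> outside \<open>S\<close>. This yields the independence of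
  a row from the resolvent of the remaining matrix.\<close>

lemma resolvent_cong:
  assumes "\<And>i j. i \<in> S \<Longrightarrow> j \<in> S \<Longrightarrow> X i j = Y i j"
  shows "resolvent S X t = resolvent S Y t"
proof -
  have "is_resolvent S X t = is_resolvent S Y t"
    unfolding is_resolvent_def fun_eq_iff using assms by (auto cong: sum.cong)
  thus ?thesis by (simp add: resolvent_def)
qed

text \<open>Sherman-Morrison: adding the constant \<open>c\<close> to all entries changes the resolvent by
  \<open>- c w w\<^sup>T / D\<close>, where \<open>w = G 1\<close> and \<open>D = 1 + c (1\<^sup>T G 1)\<close>. By the dissipation identity the imaginary part of
  \<open>D\<close> is \<open>c t \<parallel>w\<parallel>\<^sup>2\<close>, so \<open>c\<close> cancels and the bound is uniform in \<open>c\<close>.\<close>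

lemma cmod_trace_rank_one_diff:
  assumes fin: "finite S" and sym: "\<And>i j. X i j = X j i" and t: "t > 0"
    and G: "is_resolvent S X t G" and H: "is_resolvent S (\<lambda>i j. X i j + c) t H"
  shows "cmod ((\<Sum>i\<in>S. H i i) - (\<Sum>i\<in>S. G i i)) \<le> 1 / t"
proof -
  define w where "w j = (\<Sum>k\<in>S. G j k * 1)" for j
  define D where "D = 1 + of_real c * (\<Sum>j\<in>S. w j)"
  have w: "(\<Sum>j\<in>S. of_real (X l j) * w j) = \<i> * of_real t * w l + 1" if "l \<in> S" for l
    unfolding w_def by (rule resolvent_apply[OF fin G that])
  define N where "N = (\<Sum>j\<in>S. (cmod (w j))\<^sup>2)"
  have N0: "N \<ge> 0" by (simp add: N_def sum_nonneg)
  have "t * N = Im (\<Sum>j\<in>S. w j)"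
    using shifted_system_dissipation[OF fin sym w] by (simp add: N_def)
  hence ImD: "Im D = c * (t * N)" by (simp add: D_def)
  have Dge: "\<bar>c\<bar> * t * N \<le> cmod D"
    using abs_Im_le_cmod[of D] t N0 by (simp add: ImD abs_mult)
  \<comment> \<open>A zero imaginary part means \<open>c = 0\<close> or \<open>w = 0\<close>, and then \<open>D = 1\<close>.\<close>
  have D: "D \<noteq> 0"
  proof
    assume "D = 0"
    hence "c = 0 \<or> N = 0" using ImD t by simp
    moreover have "w j = 0" if "N = 0" "j \<in> S" for j
      using that fin by (simp add: N_def sum_nonneg_eq_0_iff)
    ultimately have "of_real c * (\<Sum>j\<in>S. w j) = 0" by auto
    thus False using \<open>D = 0\<close> unfolding D_def by (metis add.right_neutral one_neq_zero)
  qed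
  define H' where "H' j k = G j k - of_real c * w j * w k / D" for j k
  have "is_resolvent S (\<lambda>i j. X i j + c) t H'"
    unfolding is_resolvent_def
  proof (intro ballI)
    fix l k assume l: "l \<in> S" and k: "k \<in> S"
    have wsym: "(\<Sum>j\<in>S. G j k) = w k"
      unfolding w_def using resolvent_transpose_unique[OF fin sym G G] k by (intro sum.cong) auto
    have "(\<Sum>j\<in>S. of_real (X l j + c) * H' j k) = 
       (\<Sum>j\<in>S. of_real (X l j) * G j k + of_real c * G j k - of_real (X l j) * w j * (of_real c * w k / D) - w j * (of_real c * of_real c * w k / D))"
      by (intro sum.cong refl) (simp add: H'_def algebra_simps add_divide_distrib)
    also have "\<dots> = (\<Sum>j\<in>S. of_real (X l j) * G j k) + of_real c * (\<Sum>j\<in>S. G j k) 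
         - (\<Sum>j\<in>S. of_real (X l j) * w j) * (of_real c * w k / D) - (\<Sum>j\<in>S. w j) * (of_real c * of_real c * w k / D)"
      by (simp only: sum.distrib sum_subtractf sum_distrib_left sum_distrib_right)
    also have "\<dots> = \<i> * of_real t * G l k + of_bool (l = k) + of_real c * w k
         - (\<i> * of_real t * w l + D) * (of_real c * w k / D)"
    proof -
      define E where "E = of_real c * w k / D"
      have "(\<Sum>j\<in>S. of_real (X l j) * G j k) = \<i> * of_real t * G l k + of_bool (l = k)"
        using G l k by (auto simp: is_resolvent_def)
      moreover have "of_real c * of_real c * w k / D = of_real c * E" by (simp add: E_def)
      moreover have "u + v - (x + 1) * E - y * (of_real c * E) = u + v - (x + (1 + of_real c * y)) * E"
        for u v x y :: complex by (simp add: algebra_simps)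
      ultimately show ?thesis
        unfolding w[OF l] wsym by (simp only: E_def[symmetric] D_def[symmetric])
    qed
    also have "\<dots> = \<i> * of_real t * H' l k + of_bool (l = k)"
      using D by (simp add: H'_def field_simps)
    finally show "(\<Sum>j\<in>S. of_real (X l j + c) * H' j k) = \<i> * of_real t * H' l k + of_bool (l = k)" .
  qed
  hence "(\<Sum>i\<in>S. H i i) = (\<Sum>i\<in>S. H' i i)"
    using resolvent_unique[OF fin _ H] sym by (intro sum.cong) auto
  also have "\<dots> = (\<Sum>i\<in>S. G i i) - of_real c * (\<Sum>i\<in>S. w i * w i) / D"
    by (simp add: H'_def sum_subtractf sum_distrib_left sum_divide_distrib mult.assoc)
  finally have "cmod ((\<Sum>i\<in>S. H i i) - (\<Sum>i\<in>S. G i i)) = \<bar>c\<bar> * cmod (\<Sum>i\<in>S. w i * w i) / cmod D"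
    by (simp add: norm_mult norm_divide)
  also have "\<dots> \<le> \<bar>c\<bar> * N / cmod D"
    unfolding N_def by (intro divide_right_mono mult_left_mono sum_norm_le) (auto simp: norm_mult power2_eq_square)
  also have "\<dots> \<le> 1 / t" using Dge t D by (simp add: field_simps)
  finally show ?thesis .
qed

text \<open>The trace of \<open>H\<^sup>T (Y - X) G\<close> is the Frobenius inner product of \<open>Y - X\<close> and \<open>H G\<^sup>T\<close>. Apply the
  Cauchy-Schwarz inequality, and bound the second factor column by column by the operator norm of \<open>H\<close>
  times the norms of the columns of \<open>G\<close>.\<close>

lemma cmod_trace_frobenius_diff:
  assumes fin: "finite S" and symX: "\<And>i j. X i j = X j i" and symY: "\<And>i j. Y i j = Y j i" and t: "t > 0"
    and G: "is_resolvent S X t G" and H: "is_resolvent S Y t H"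
  shows "cmod ((\<Sum>i\<in>S. G i i) - (\<Sum>i\<in>S. H i i))
    \<le> sqrt (\<Sum>i\<in>S. \<Sum>j\<in>S. (Y i j - X i j)\<^sup>2) * sqrt (real (card S)) / t\<^sup>2"
proof -
  define K where "K i j = (\<Sum>a\<in>S. H i a * G j a)" for i j
  have Gsym: "G a b = G b a" if "a \<in> S" "b \<in> S" for a b
    using resolvent_transpose_unique[OF fin symX G G] that by auto
  have "(\<Sum>a\<in>S. G a a) - (\<Sum>a\<in>S. H a a) = (\<Sum>a\<in>S. \<Sum>i\<in>S. \<Sum>j\<in>S. H i a * of_real (Y i j - X i j) * G j a)"
    using resolvent_identity[OF fin symX G H symY] by (simp add: sum_subtractf)
  also have "\<dots> = (\<Sum>i\<in>S. \<Sum>a\<in>S. \<Sum>j\<in>S. H i a * of_real (Y i j - X i j) * G j a)"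
    by (rule sum.swap)
  also have "\<dots> = (\<Sum>i\<in>S. \<Sum>j\<in>S. of_real (Y i j - X i j) * K i j)"
  proof (rule sum.cong[OF refl])
    fix i assume "i \<in> S"
    show "(\<Sum>a\<in>S. \<Sum>j\<in>S. H i a * of_real (Y i j - X i j) * G j a) = (\<Sum>j\<in>S. of_real (Y i j - X i j) * K i j)"
      unfolding K_def sum_distrib_left
      by (subst sum.swap) (intro sum.cong refl, simp only: mult_ac)
  qed
  also have "cmod \<dots> \<le> (\<Sum>i\<in>S. \<Sum>j\<in>S. \<bar>Y i j - X i j\<bar> * cmod (K i j))"
    by (intro sum_norm_le) (simp add: norm_mult del: of_real_diff)
  also have "\<dots> = (\<Sum>x\<in>S\<times>S. (case x of (i,j) \<Rightarrow> \<bar>Y i j - X i j\<bar>) * (case x of (i,j) \<Rightarrow> cmod (K i j)))"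
    by (simp add: sum.cartesian_product case_prod_beta)
  also have "\<dots> \<le> sqrt (\<Sum>x\<in>S\<times>S. (case x of (i,j) \<Rightarrow> \<bar>Y i j - X i j\<bar>)\<^sup>2) * sqrt (\<Sum>x\<in>S\<times>S. (case x of (i,j) \<Rightarrow> cmod (K i j))\<^sup>2)"
    unfolding real_sqrt_mult[symmetric] by (intro real_le_rsqrt Cauchy_Schwarz_ineq_sum)
  also have "\<dots> = sqrt (\<Sum>i\<in>S. \<Sum>j\<in>S. (Y i j - X i j)\<^sup>2) * sqrt (\<Sum>i\<in>S. \<Sum>j\<in>S. (cmod (K i j))\<^sup>2)"
    by (simp add: sum.cartesian_product case_prod_beta)
  also have "(\<Sum>i\<in>S. \<Sum>j\<in>S. (cmod (K i j))\<^sup>2) = (\<Sum>j\<in>S. \<Sum>i\<in>S. (cmod (K i j))\<^sup>2)" by (rule sum.swap)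
  also have "\<dots> \<le> (\<Sum>j\<in>S. (1 / t\<^sup>2) / t\<^sup>2)"
  proof (rule sum_mono)
    fix j assume j: "j \<in> S"
    have "(\<Sum>i\<in>S. (cmod (K i j))\<^sup>2) \<le> (\<Sum>i\<in>S. (cmod (G j i))\<^sup>2) / t\<^sup>2"
      unfolding K_def by (rule shifted_system_bound[OF fin symY t resolvent_apply[OF fin H]])
    also have "(\<Sum>i\<in>S. (cmod (G j i))\<^sup>2) = (\<Sum>i\<in>S. (cmod (G i j))\<^sup>2)"
      using Gsym j by (intro sum.cong) auto
    also have "\<dots> / t\<^sup>2 \<le> (1 / t\<^sup>2) / t\<^sup>2"
      by (intro divide_right_mono resolvent_column_norm[OF fin symX t G j]) auto
    finally show "(\<Sum>i\<in>S. (cmod (K i j))\<^sup>2) \<le> (1 / t\<^sup>2) / t\<^sup>2" .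
  qed
  also have "\<dots> = real (card S) / (t\<^sup>2)\<^sup>2" by (simp add: power2_eq_square)
  also have "sqrt \<dots> = sqrt (real (card S)) / t\<^sup>2" by (simp only: real_sqrt_divide real_sqrt_abs abs_power2)
  finally show ?thesis
    by (simp add: mult_left_mono sum_nonneg)
qed

section \<open>Eigenvalues and traces\<close>

lemma monic_real_poly_splits:
  fixes p :: "real poly"
  assumes "size (proots p) = degree p" "lead_coeff p = 1"
  shows "p = (\<Prod>x\<in>#proots p. [:- x, 1:])"
  using assms
proof (induction "degree p" arbitrary: p)
  case 0
  thus ?case by (metis degree_0_id image_mset_empty one_pCons prod_mset_empty size_eq_0_iff_empty)
next
  case (Suc d)
  from Suc have "proots p \<noteq> {#}" by auto
  then obtain x where "x \<in># proots p" by blast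
  moreover have p0: "p \<noteq> 0" using Suc by auto
  ultimately have "poly p x = 0" by simp
  then obtain q where p: "p = [:- x, 1:] * q" by (auto simp: poly_eq_0_iff_dvd)
  have q0: "q \<noteq> 0" using p p0 by auto
  have roots: "proots p = {#x#} + proots q"
    unfolding p using q0 by (subst proots_mult) (auto simp del: mult_pCons_left)
  have deg: "degree p = Suc (degree q)"
    unfolding p using q0 by (subst degree_mult_eq) (auto simp del: mult_pCons_left)
  have "lead_coeff q = 1"
    using Suc.prems(2) unfolding p by (subst (asm) lead_coeff_mult) simp
  hence "q = (\<Prod>x\<in>#proots q. [:- x, 1:])"
    using Suc deg roots by (intro Suc.hyps(1)) auto
  thus ?case unfolding roots using p by simp
qed

text \<open>The eigenvalues of a real symmetric matrix are real, so its characteristic polynomial splits and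
  the Schur decomposition applies. A triangular form is as good as a diagonal one here, because only
  traces are read off.\<close>

lemma symmetric_mat_triangularization:
  fixes A :: "real mat"
  assumes A: "A \<in> carrier_mat n n" and sym: "transpose_mat A = A"
  obtains es :: "real list" and B P Q :: "complex mat" where
    "mset es = eigenvalues_mset A" "length es = n"
    "similar_mat_wit (map_mat complex_of_real A) B P Q"
    "upper_triangular B" "\<And>i. i < n \<Longrightarrow> B $$ (i, i) = complex_of_real (es ! i)"
proof -
  interpret c: map_poly_inj_idom_hom complex_of_real ..
  obtain es where es: "mset es = eigenvalues_mset A" using ex_mset by blast
  have len: "length es = n"
    using size_eigenvalues_symmetric[OF A sym] es by (metis size_mset)
  have "char_poly A = (\<Prod>x\<in>#proots (char_poly A). [:- x, 1:])"
    using degree_monic_char_poly[OF A] size_eigenvalues_symmetric[OF A sym]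
    by (intro monic_real_poly_splits) (auto simp: eigenvalues_mset_def)
  also have "\<dots> = (\<Prod>a\<leftarrow>es. [:- a, 1:])"
    by (metis es eigenvalues_mset_def mset_map prod_mset_prod_list)
  finally have cp: "char_poly A = (\<Prod>a\<leftarrow>es. [:- a, 1:])" .
  have "char_poly (map_mat complex_of_real A) = map_poly complex_of_real (char_poly A)"
    by (rule of_real_hom.char_poly_hom[OF A])
  also have "\<dots> = (\<Prod>a\<leftarrow>map complex_of_real es. [:- a, 1:])"
    unfolding cp c.hom_prod_list map_map
    by (intro arg_cong[where f = prod_list] map_cong refl) simp
  finally have cp': "char_poly (map_mat complex_of_real A) = (\<Prod>a\<leftarrow>map complex_of_real es. [:- a, 1:])" .
  have A': "map_mat complex_of_real A \<in> carrier_mat n n" using A by simp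
  obtain B P Q where "schur_decomposition (map_mat complex_of_real A) (map complex_of_real es) = (B, P, Q)"
    by (cases "schur_decomposition (map_mat complex_of_real A) (map complex_of_real es)") auto
  note S = schur_decomposition[OF A' cp' this]
  have "B $$ (i, i) = complex_of_real (es ! i)" if "i < n" for i
  proof -
    have "dim_row B = n" using S similar_mat_witD2(5)[OF A'] by blast
    moreover have "diag_mat B ! i = complex_of_real (es ! i)" using S that len by simp
    ultimately show ?thesis using that by (simp add: diag_mat_def)
  qed
  with that es len S show thesis by blast
qed

lemma trace_mult_commute:
  fixes X Y :: "'a::comm_semiring_0 mat"
  assumes "X \<in> carrier_mat n n" "Y \<in> carrier_mat n n"
  shows "(\<Sum>i<n. (X * Y) $$ (i, i)) = (\<Sum>i<n. (Y * X) $$ (i, i))"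
proof -
  have "(\<Sum>i<n. (X * Y) $$ (i, i)) = (\<Sum>i<n. \<Sum>j<n. X $$ (i, j) * Y $$ (j, i))"
    using assms by (intro sum.cong) (auto simp: scalar_prod_def lessThan_atLeast0)
  also have "\<dots> = (\<Sum>j<n. \<Sum>i<n. Y $$ (j, i) * X $$ (i, j))"
    by (subst sum.swap) (simp add: mult.commute)
  also have "\<dots> = (\<Sum>i<n. (Y * X) $$ (i, i))"
    using assms by (intro sum.cong) (auto simp: scalar_prod_def lessThan_atLeast0)
  finally show ?thesis .
qed

lemma trace_similar:
  fixes X P Q :: "'a::comm_ring_1 mat"
  assumes "X \<in> carrier_mat n n" "P \<in> carrier_mat n n" "Q \<in> carrier_mat n n" "Q * P = 1\<^sub>m n"
  shows "(\<Sum>i<n. (P * X * Q) $$ (i, i)) = (\<Sum>i<n. X $$ (i, i))"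
proof -
  have "(\<Sum>i<n. (P * X * Q) $$ (i, i)) = (\<Sum>i<n. (Q * (P * X)) $$ (i, i))"
    using assms by (intro trace_mult_commute) auto
  also have "Q * (P * X) = X" using assms by (simp flip: assoc_mult_mat[of _ n n _ n _ n])
  finally show ?thesis .
qed

lemma sum_upper_triangular_row:
  fixes B :: "complex mat"
  assumes "upper_triangular B" "B \<in> carrier_mat n n" "i < n" "\<And>j. i < j \<Longrightarrow> j < n \<Longrightarrow> f j = 0"
  shows "(\<Sum>j<n. B $$ (i, j) * f j) = B $$ (i, i) * f i"
proof -
  have "(\<Sum>j<n. B $$ (i, j) * f j) = (\<Sum>j\<in>{i}. B $$ (i, j) * f j)"
  proof (rule sum.mono_neutral_right)
    show "\<forall>j\<in>{..<n} - {i}. B $$ (i, j) * f j = 0"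
    proof
      fix j assume "j \<in> {..<n} - {i}"
      hence "j < i \<or> (i < j \<and> j < n)" by auto
      thus "B $$ (i, j) * f j = 0"
        using assms upper_triangularD[OF assms(1), of j i] by auto
    qed
  qed (use assms in auto)
  thus ?thesis by simp
qed

text \<open>Both sides are the trace of \<open>A\<^sup>2\<close>; for a triangular matrix the diagonal of the square consists of
  the squares of the diagonal.\<close>

lemma sum_eigenvalues_squared:
  fixes A :: "real mat"
  assumes A: "A \<in> carrier_mat n n" and sym: "transpose_mat A = A"
  shows "(\<Sum>x\<in>#eigenvalues_mset A. x\<^sup>2) = (\<Sum>i<n. \<Sum>j<n. (A $$ (i, j))\<^sup>2)"
proof -
  let ?A = "map_mat complex_of_real A"
  obtain es B P Q where es: "mset es = eigenvalues_mset A" "length es = n"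
    and sim: "similar_mat_wit ?A B P Q"
    and B: "upper_triangular B" "\<And>i. i < n \<Longrightarrow> B $$ (i, i) = complex_of_real (es ! i)"
    using symmetric_mat_triangularization[OF A sym] by metis
  have A': "?A \<in> carrier_mat n n" using A by simp
  note D = similar_mat_witD2[OF A' sim]
  have "?A * ?A = P * (B * B) * Q"
  proof -
    have "?A * ?A = (P * B * Q) * (P * B * Q)" using D by simp
    also have "\<dots> = P * B * (Q * P) * (B * Q)"
      using D(5-7) by (simp add: assoc_mult_mat[of _ n n _ n _ n])
    also have "\<dots> = P * (B * B) * Q"
      using D(2,5-7) by (simp add: assoc_mult_mat[of _ n n _ n _ n])
    finally show ?thesis .
  qed
  hence "(\<Sum>i<n. (?A * ?A) $$ (i, i)) = (\<Sum>i<n. (B * B) $$ (i, i))"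
    using trace_similar[of "B * B" n P Q] D by simp
  also have "\<dots> = (\<Sum>i<n. (complex_of_real (es ! i))\<^sup>2)"
  proof (rule sum.cong[OF refl])
    fix i assume i: "i \<in> {..<n}"
    have "(B * B) $$ (i, i) = (\<Sum>j<n. B $$ (i, j) * B $$ (j, i))"
      using i D by (auto simp: scalar_prod_def lessThan_atLeast0 intro!: sum.cong)
    also have "\<dots> = B $$ (i, i) * B $$ (i, i)"
      using i D(5) by (intro sum_upper_triangular_row B(1)) (auto intro: upper_triangularD[OF B(1)])
    finally show "(B * B) $$ (i, i) = (complex_of_real (es ! i))\<^sup>2"
      using i B(2) by (simp add: power2_eq_square)
  qed
  also have "\<dots> = of_real (\<Sum>i<n. (es ! i)\<^sup>2)" by simp
  also have "(\<Sum>i<n. (es ! i)\<^sup>2) = (\<Sum>x\<leftarrow>es. x\<^sup>2)"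
    using es(2) by (simp add: sum_list_sum_nth lessThan_atLeast0)
  also have "(\<Sum>i<n. (?A * ?A) $$ (i, i)) = of_real (\<Sum>i<n. \<Sum>j<n. (A $$ (i, j))\<^sup>2)"
    unfolding of_real_sum
  proof (intro sum.cong refl)
    fix i assume i: "i \<in> {..<n}"
    have "(?A * ?A) $$ (i, i) = (\<Sum>j<n. complex_of_real (A $$ (i, j)) * complex_of_real (A $$ (j, i)))"
      using i A by (auto simp: scalar_prod_def lessThan_atLeast0 intro!: sum.cong)
    also have "\<dots> = (\<Sum>j<n. complex_of_real ((A $$ (i, j))\<^sup>2))"
    proof (rule sum.cong[OF refl])
      fix j assume j: "j \<in> {..<n}"
      have "A $$ (j, i) = A $$ (i, j)"
        using A sym i j by (metis carrier_matD index_transpose_mat(1) lessThan_iff)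
      thus "complex_of_real (A $$ (i, j)) * complex_of_real (A $$ (j, i)) = complex_of_real ((A $$ (i, j))\<^sup>2)"
        by (simp add: power2_eq_square)
    qed
    finally show "(?A * ?A) $$ (i, i) = (\<Sum>j<n. complex_of_real ((A $$ (i, j))\<^sup>2))" .
  qed
  finally show ?thesis unfolding of_real_eq_iff
    by (metis es(1) mset_map sum_mset_sum_list)
qed

text \<open>In the basis in which \<open>A\<close> is the triangular matrix \<open>B\<close>, the resolvent becomes the inverse \<open>W\<close> of
  \<open>B - i t\<close>. It is again upper triangular, hence its diagonal entries are the inverses of those of
  \<open>B - i t\<close>.\<close>

lemma trace_resolvent_eigenvalues:
  fixes A :: "real mat"
  assumes A: "A \<in> carrier_mat n n" and sym: "transpose_mat A = A" and t: "t \<noteq> 0"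
    and G: "is_resolvent {..<n} (\<lambda>i j. A $$ (i, j)) t G"
  shows "(\<Sum>i<n. G i i) = (\<Sum>x\<in>#eigenvalues_mset A. 1 / (complex_of_real x - \<i> * of_real t))"
proof -
  let ?A = "map_mat complex_of_real A"
  let ?z = "\<i> * complex_of_real t"
  obtain es B P Q where es: "mset es = eigenvalues_mset A" "length es = n"
    and sim: "similar_mat_wit ?A B P Q"
    and B: "upper_triangular B" "\<And>i. i < n \<Longrightarrow> B $$ (i, i) = complex_of_real (es ! i)"
    using symmetric_mat_triangularization[OF A sym] by metis
  have A': "?A \<in> carrier_mat n n" using A by simp
  note D = similar_mat_witD2[OF A' sim]
  define H where "H = Matrix.mat n n (\<lambda>(i, j). G i j)"
  have H: "H \<in> carrier_mat n n" by (simp add: H_def)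
  define W where "W = Q * H * P"
  have W: "W \<in> carrier_mat n n" using D H by (simp add: W_def)
  have AH: "?A * H = ?z \<cdot>\<^sub>m H + 1\<^sub>m n"
  proof (rule eq_matI)
    fix i j assume "i < dim_row (?z \<cdot>\<^sub>m H + 1\<^sub>m n)" "j < dim_col (?z \<cdot>\<^sub>m H + 1\<^sub>m n)"
    hence ij: "i < n" "j < n" by (auto simp: H_def)
    have "(?A * H) $$ (i, j) = (\<Sum>k<n. of_real (A $$ (i, k)) * G k j)"
      using ij A by (auto simp: H_def scalar_prod_def lessThan_atLeast0 intro!: sum.cong)
    also have "\<dots> = ?z * G i j + of_bool (i = j)" using G ij by (simp add: is_resolvent_def)
    finally show "(?A * H) $$ (i, j) = (?z \<cdot>\<^sub>m H + 1\<^sub>m n) $$ (i, j)"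
      using ij by (simp add: H_def)
  qed (use A H in auto)
  have "B * W = ?z \<cdot>\<^sub>m W + 1\<^sub>m n"
  proof -
    have "Q * ?A = B * Q"
    proof -
      have "Q * ?A = Q * (P * B * Q)" using D by simp
      also have "\<dots> = (Q * P) * B * Q" using D(5-7) by (simp add: assoc_mult_mat[of _ n n _ n _ n])
      finally show ?thesis using D by simp
    qed
    have "B * W = (B * Q) * H * P"
      unfolding W_def using D(5-7) H by (simp add: assoc_mult_mat[of _ n n _ n _ n])
    also have "\<dots> = Q * (?A * H) * P"
      unfolding \<open>Q * ?A = B * Q\<close>[symmetric] using D(4-7) H A' by (simp add: assoc_mult_mat[of _ n n _ n _ n])
    also have "\<dots> = Q * (?z \<cdot>\<^sub>m H) * P + Q * 1\<^sub>m n * P"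
      unfolding AH using D(5-7) H
      by (subst mult_add_distrib_mat[of _ n n _ n], simp_all, subst add_mult_distrib_mat[of _ n n _ _ n], simp_all)
    also have "Q * (?z \<cdot>\<^sub>m H) * P = ?z \<cdot>\<^sub>m W"
      unfolding W_def using D(5-7) H
      by (subst mult_smult_distrib[of _ n n _ n], simp_all, subst mult_smult_assoc_mat[of _ n n _ n], simp_all)
    finally show ?thesis using D by simp
  qed
  hence eq: "(\<Sum>j<n. B $$ (i, j) * W $$ (j, k)) = ?z * W $$ (i, k) + of_bool (i = k)" if "i < n" "k < n" for i k
  proof -
    have "(\<Sum>j<n. B $$ (i, j) * W $$ (j, k)) = (B * W) $$ (i, k)"
      using that D W by (auto simp: scalar_prod_def lessThan_atLeast0 intro!: sum.cong)
    thus ?thesis unfolding \<open>B * W = _\<close> using that W by simp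
  qed
  have nz: "B $$ (i, i) - ?z \<noteq> 0" if "i < n" for i
    using B(2)[OF that] t by (auto simp: complex_eq_iff)
  \<comment> \<open>Back substitution from the last row: below the diagonal the right-hand side is zero.\<close>
  have low: "W $$ (i, k) = 0" if "k < i" "i < n" for i k
    using that
  proof (induction "n - i" arbitrary: i rule: less_induct)
    case less
    have "(\<Sum>j<n. B $$ (i, j) * W $$ (j, k)) = B $$ (i, i) * W $$ (i, k)"
      using less D(5) by (intro sum_upper_triangular_row B(1)) auto
    hence "B $$ (i, i) * W $$ (i, k) = ?z * W $$ (i, k) + 0"
      using eq[of i k] less.prems by (simp only: of_bool_def) auto
    hence "(B $$ (i, i) - ?z) * W $$ (i, k) = 0"
      by (simp only: left_diff_distrib) simp
    thus ?case using nz[OF less.prems(2)] by simp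
  qed
  have diag: "W $$ (i, i) = 1 / (complex_of_real (es ! i) - ?z)" if i: "i < n" for i
  proof -
    have "(\<Sum>j<n. B $$ (i, j) * W $$ (j, i)) = B $$ (i, i) * W $$ (i, i)"
      using i D(5) low by (intro sum_upper_triangular_row B(1)) auto
    hence "(B $$ (i, i) - ?z) * W $$ (i, i) = 1"
      using eq[of i i] i by (simp add: algebra_simps)
    thus ?thesis using nz[OF i] B(2)[OF i] by (simp add: field_simps)
  qed
  have "(\<Sum>i<n. G i i) = (\<Sum>i<n. H $$ (i, i))" by (simp add: H_def)
  also have "\<dots> = (\<Sum>i<n. W $$ (i, i))"
    unfolding W_def using D H by (intro trace_similar[symmetric]) auto
  also have "\<dots> = (\<Sum>i<n. 1 / (complex_of_real (es ! i) - ?z))" using diag by simp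
  also have "\<dots> = (\<Sum>x\<leftarrow>es. 1 / (complex_of_real x - ?z))"
    using es(2) by (simp add: sum_list_sum_nth lessThan_atLeast0)
  finally show ?thesis by (metis es(1) mset_map sum_mset_sum_list)
qed

section \<open>Linear and quadratic forms in centered Bernoulli variables\<close>

text \<open>A function of a family of bits that ignores the coordinate \<open>e\<close>. This is the form in which
  independence is used below.\<close>

definition ignores :: "'e \<Rightarrow> (('e \<Rightarrow> bool) \<Rightarrow> 'b) \<Rightarrow> bool" where
  "ignores e H \<longleftrightarrow> (\<forall>f b. H (f(e := b)) = H f)"

lemma ignoresD: "ignores e H \<Longrightarrow> H (f(e := b)) = H f"
  by (simp add: ignores_def)

locale bernoulli_product =
  fixes A :: "'e set" and p :: real
  assumes finite_A: "finite A" and p_ge: "0 \<le> p" and p_le: "p \<le> 1"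
begin

abbreviation M :: "('e \<Rightarrow> bool) pmf" where
  "M \<equiv> Pi_pmf A False (\<lambda>_. bernoulli_pmf p)"

abbreviation E :: "(('e \<Rightarrow> bool) \<Rightarrow> real) \<Rightarrow> real" where
  "E F \<equiv> measure_pmf.expectation M F"

definition \<eta> :: "'e \<Rightarrow> ('e \<Rightarrow> bool) \<Rightarrow> real" where
  "\<eta> e f = of_bool (f e) - p"

lemma finite_set_Pi_bernoulli: "finite B \<Longrightarrow> finite (set_pmf (Pi_pmf B False (\<lambda>_. bernoulli_pmf p)))"
  by (rule finite_subset[OF set_Pi_pmf_subset'])
     (auto intro!: finite_PiE_dflt)

lemma integrable_M [simp, intro]: "integrable (measure_pmf M) (F :: _ \<Rightarrow> real)"
  using finite_set_Pi_bernoulli[OF finite_A] by (rule integrable_measure_pmf_finite)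

lemma E_mono: "(\<And>f. F f \<le> G f) \<Longrightarrow> E F \<le> E G"
  by (intro integral_mono) auto

lemma E_abs_le_sqrt: "E (\<lambda>f. \<bar>F f\<bar>) \<le> sqrt (E (\<lambda>f. (F f)\<^sup>2))"
proof (rule real_le_rsqrt)
  show "(E (\<lambda>f. \<bar>F f\<bar>))\<^sup>2 \<le> E (\<lambda>f. (F f)\<^sup>2)"
    using measure_pmf.variance_positive[of M "\<lambda>f. \<bar>F f\<bar>"]
      measure_pmf.variance_eq[of M "\<lambda>f. \<bar>F f\<bar>"] by simp
qed

text \<open>Conditioning on one coordinate. All uses of independence are reduced to this identity.\<close>

lemma E_resample:
  assumes e: "e \<in> A"
  shows "E K = p * E (\<lambda>f. K (f(e := True))) + (1 - p) * E (\<lambda>f. K (f(e := False)))"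
proof -
  let ?M' = "Pi_pmf (A - {e}) False (\<lambda>_. bernoulli_pmf p)"
  have M: "M = bernoulli_pmf p \<bind> (\<lambda>y. map_pmf (\<lambda>f. f(e := y)) ?M')"
    using Pi_pmf_insert'[of "A - {e}" e False "\<lambda>_. bernoulli_pmf p"] finite_A e
    by (simp add: insert_absorb map_pmf_def)
  have *: "E K = p * measure_pmf.expectation ?M' (\<lambda>f. K (f(e := True)))
      + (1 - p) * measure_pmf.expectation ?M' (\<lambda>f. K (f(e := False)))" for K :: "_ \<Rightarrow> real"
    unfolding M using finite_A p_ge p_le
    by (subst pmf_expectation_bind[of UNIV]) (auto simp: UNIV_bool finite_set_Pi_bernoulli)
  show ?thesis
    using *[of K] *[of "\<lambda>f. K (f(e := True))"] *[of "\<lambda>f. K (f(e := False))"]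
    by (simp add: algebra_simps)
qed

lemma E_factor:
  assumes e: "e \<in> A" and H: "ignores e H"
  shows "E (\<lambda>f. \<phi> (f e) * H f) = (p * \<phi> True + (1 - p) * \<phi> False) * E H"
  by (subst E_resample[OF e]) (simp add: ignoresD[OF H] algebra_simps)

lemma
  assumes e: "e \<in> A" and H: "ignores e H"
  shows E_eta: "E (\<lambda>f. \<eta> e f * H f) = 0"
    and E_eta_sq: "E (\<lambda>f. (\<eta> e f)\<^sup>2 * H f) = p * (1 - p) * E H"
    and E_eta_sq_centered: "E (\<lambda>f. ((\<eta> e f)\<^sup>2 - p * (1 - p)) * H f) = 0"
  unfolding \<eta>_def
  by (subst E_factor[OF e H, of "\<lambda>b. of_bool b - p"], simp add: algebra_simps,
      subst E_factor[OF e H, of "\<lambda>b. (of_bool b - p)\<^sup>2"], simp add: algebra_simps power2_eq_square,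
      subst E_factor[OF e H, of "\<lambda>b. (of_bool b - p)\<^sup>2 - p * (1 - p)"], simp add: algebra_simps power2_eq_square)

lemma p1p: "0 \<le> p * (1 - p)" "p * (1 - p) \<le> 1"
  using p_ge p_le by (auto simp: mult_le_one)

lemma eta_sq_le: "(\<eta> e f)\<^sup>2 \<le> 1"
  unfolding \<eta>_def using p_ge p_le by (cases "f e") (auto simp: power_le_one abs_square_le_1[symmetric] power2_commute)

text \<open>The coefficients may be random as long as they do not depend on the variables of the form. Adding
  one variable at a time, the mixed term has expectation zero because \<open>\<eta>\<close> is centered.\<close>

lemma E_linear_form_sq:
  assumes "finite T" "inj_on \<epsilon> T" "\<epsilon> ` T \<subseteq> A"
    and "\<And>j l. j \<in> T \<Longrightarrow> l \<in> T \<Longrightarrow> ignores (\<epsilon> l) (B j)"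
  shows "E (\<lambda>f. (\<Sum>j\<in>T. B j f * \<eta> (\<epsilon> j) f)\<^sup>2) = p * (1 - p) * (\<Sum>j\<in>T. E (\<lambda>f. (B j f)\<^sup>2))"
  using assms
proof (induction T)
  case empty
  show ?case by simp
next
  case (insert l T)
  define Y where "Y f = (\<Sum>j\<in>T. B j f * \<eta> (\<epsilon> j) f)" for f
  have l: "\<epsilon> l \<in> A" using insert by simp
  have Y: "Y (f(\<epsilon> l := b)) = Y f" for f b
    unfolding Y_def
  proof (rule sum.cong[OF refl])
    fix j assume j: "j \<in> T"
    hence "\<epsilon> j \<noteq> \<epsilon> l" using insert.prems insert.hyps by (auto simp: inj_on_def)
    hence "\<eta> (\<epsilon> j) (f(\<epsilon> l := b)) = \<eta> (\<epsilon> j) f" by (simp add: \<eta>_def)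
    moreover have "B j (f(\<epsilon> l := b)) = B j f"
      using j by (intro ignoresD insert.prems(3)) simp_all
    ultimately show "B j (f(\<epsilon> l := b)) * \<eta> (\<epsilon> j) (f(\<epsilon> l := b)) = B j f * \<eta> (\<epsilon> j) f"
      by (simp only:)
  qed
  have Bl: "B l (f(\<epsilon> l := b)) = B l f" for f b by (rule ignoresD[OF insert.prems(3)]) simp_all
  have "E (\<lambda>f. (\<Sum>j\<in>insert l T. B j f * \<eta> (\<epsilon> j) f)\<^sup>2) =
     E (\<lambda>f. (Y f)\<^sup>2 + \<eta> (\<epsilon> l) f * (2 * B l f * Y f) + (\<eta> (\<epsilon> l) f)\<^sup>2 * (B l f)\<^sup>2)"
    using insert.hyps by (intro arg_cong[where f = E] ext) (simp add: Y_def[symmetric] power2_eq_square algebra_simps)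
  also have "\<dots> = E (\<lambda>f. (Y f)\<^sup>2) + E (\<lambda>f. \<eta> (\<epsilon> l) f * (2 * B l f * Y f)) + E (\<lambda>f. (\<eta> (\<epsilon> l) f)\<^sup>2 * (B l f)\<^sup>2)"
    by simp
  also have "E (\<lambda>f. \<eta> (\<epsilon> l) f * (2 * B l f * Y f)) = 0"
    by (rule E_eta[OF l]) (simp add: ignores_def Y Bl)
  also have "E (\<lambda>f. (\<eta> (\<epsilon> l) f)\<^sup>2 * (B l f)\<^sup>2) = p * (1 - p) * E (\<lambda>f. (B l f)\<^sup>2)"
    by (rule E_eta_sq[OF l]) (simp add: ignores_def Bl)
  also have "E (\<lambda>f. (Y f)\<^sup>2) = p * (1 - p) * (\<Sum>j\<in>T. E (\<lambda>f. (B j f)\<^sup>2))"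
    unfolding Y_def using insert.prems by (intro insert.IH) auto
  finally show ?case using insert.hyps by (simp add: algebra_simps)
qed

text \<open>A quadratic form minus its conditional mean. Adding the index \<open>l\<close> changes it by
  \<open>2 \<eta>\<^sub>l Y + (\<eta>\<^sub>l\<^sup>2 - p (1 - p)) B\<^sub>l\<^sub>l\<close>, where \<open>Y\<close> is a linear form in the earlier variables. Both terms are
  centered given everything else, so the second moments add up, and the second moment of \<open>Y\<close> is that
  of the previous lemma. The constant 8 is convenient, not optimal.\<close>

lemma E_quadratic_form_sq:
  assumes "finite T" "inj_on \<epsilon> T" "\<epsilon> ` T \<subseteq> A"
    and "\<And>j k l. j \<in> T \<Longrightarrow> k \<in> T \<Longrightarrow> l \<in> T \<Longrightarrow> ignores (\<epsilon> l) (B j k)"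
    and "\<And>j k f. j \<in> T \<Longrightarrow> k \<in> T \<Longrightarrow> B j k f = B k j f"
  shows "E (\<lambda>f. ((\<Sum>j\<in>T. \<Sum>k\<in>T. B j k f * \<eta> (\<epsilon> j) f * \<eta> (\<epsilon> k) f) - p * (1 - p) * (\<Sum>j\<in>T. B j j f))\<^sup>2)
     \<le> 8 * (\<Sum>j\<in>T. \<Sum>k\<in>T. E (\<lambda>f. (B j k f)\<^sup>2))"
  using assms
proof (induction T)
  case empty
  show ?case by simp
next
  case (insert l T)
  define Y where "Y f = (\<Sum>j\<in>T. B j l f * \<eta> (\<epsilon> j) f)" for f
  define Q where "Q f = (\<Sum>j\<in>T. \<Sum>k\<in>T. B j k f * \<eta> (\<epsilon> j) f * \<eta> (\<epsilon> k) f) - p * (1 - p) * (\<Sum>j\<in>T. B j j f)" for f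
  define h where "h f = \<eta> (\<epsilon> l) f" for f
  define g where "g f = (h f)\<^sup>2 - p * (1 - p)" for f
  have l: "\<epsilon> l \<in> A" using insert by simp
  have \<eta>T: "\<eta> (\<epsilon> j) (f(\<epsilon> l := b)) = \<eta> (\<epsilon> j) f" if "j \<in> T" for j f b
    using that insert.prems insert.hyps by (auto simp: \<eta>_def inj_on_def)
  have BT: "B j k (f(\<epsilon> l := b)) = B j k f" if "j \<in> insert l T" "k \<in> insert l T" for j k f b
    using that by (intro ignoresD insert.prems(3)) simp_all
  have Y: "Y (f(\<epsilon> l := b)) = Y f" for f b
    unfolding Y_def by (intro sum.cong refl) (simp add: \<eta>T BT)
  have Q: "Q (f(\<epsilon> l := b)) = Q f" for f b
    unfolding Q_def by (intro arg_cong2[where f = minus] arg_cong2[where f = times] refl sum.cong) (simp_all add: \<eta>T BT)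
  have Bl: "B l l (f(\<epsilon> l := b)) = B l l f" for f b by (simp add: BT)
  have "E (\<lambda>f. ((\<Sum>j\<in>insert l T. \<Sum>k\<in>insert l T. B j k f * \<eta> (\<epsilon> j) f * \<eta> (\<epsilon> k) f) - p * (1 - p) * (\<Sum>j\<in>insert l T. B j j f))\<^sup>2)
     = E (\<lambda>f. (Q f + (2 * h f * Y f + g f * B l l f))\<^sup>2)"
  proof (intro arg_cong[where f = E] ext arg_cong[where f = "\<lambda>x. x\<^sup>2"])
    fix f
    have "(\<Sum>j\<in>insert l T. \<Sum>k\<in>insert l T. B j k f * \<eta> (\<epsilon> j) f * \<eta> (\<epsilon> k) f)
      = B l l f * h f * h f + (\<Sum>k\<in>T. B l k f * h f * \<eta> (\<epsilon> k) f) + (\<Sum>j\<in>T. B j l f * \<eta> (\<epsilon> j) f * h f)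
       + (\<Sum>j\<in>T. \<Sum>k\<in>T. B j k f * \<eta> (\<epsilon> j) f * \<eta> (\<epsilon> k) f)"
      using insert.hyps by (simp add: sum.distrib h_def)
    also have "(\<Sum>k\<in>T. B l k f * h f * \<eta> (\<epsilon> k) f) = h f * Y f"
      unfolding Y_def sum_distrib_left using insert.prems by (intro sum.cong) (auto simp: mult_ac)
    also have "(\<Sum>j\<in>T. B j l f * \<eta> (\<epsilon> j) f * h f) = h f * Y f"
      unfolding Y_def sum_distrib_left by (intro sum.cong) (auto simp: mult_ac)
    finally show "(\<Sum>j\<in>insert l T. \<Sum>k\<in>insert l T. B j k f * \<eta> (\<epsilon> j) f * \<eta> (\<epsilon> k) f) - p * (1 - p) * (\<Sum>j\<in>insert l T. B j j f)
      = Q f + (2 * h f * Y f + g f * B l l f)"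
      using insert.hyps by (simp add: Q_def g_def power2_eq_square algebra_simps)
  qed
  also have "\<dots> \<le> E (\<lambda>f. (Q f)\<^sup>2 + h f * (4 * Y f * Q f) + g f * (2 * B l l f * Q f) + 8 * ((h f)\<^sup>2 * (Y f)\<^sup>2) + 2 * (B l l f)\<^sup>2)"
  proof (rule E_mono)
    fix f
    \<comment> \<open>Both \<open>\<eta>\<^sup>2\<close> and its mean \<open>p (1 - p)\<close> lie between \<open>0\<close> and \<open>1\<close>.\<close>
    have g: "(g f)\<^sup>2 \<le> 1"
      unfolding g_def h_def using eta_sq_le[of "\<epsilon> l" f] p1p zero_le_power2[of "\<eta> (\<epsilon> l) f"]
      by (intro abs_square_le_1[THEN iffD2]) linarith
    have "(2 * h f * Y f + g f * B l l f)\<^sup>2 \<le> 2 * (2 * h f * Y f)\<^sup>2 + 2 * (g f * B l l f)\<^sup>2"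
      using zero_le_power2[of "2 * h f * Y f - g f * B l l f"] by (simp add: power2_eq_square algebra_simps)
    also have "(g f * B l l f)\<^sup>2 \<le> (B l l f)\<^sup>2"
      using mult_right_mono[OF g, of "(B l l f)\<^sup>2"] by (simp add: power_mult_distrib)
    finally show "(Q f + (2 * h f * Y f + g f * B l l f))\<^sup>2 \<le> (Q f)\<^sup>2 + h f * (4 * Y f * Q f) + g f * (2 * B l l f * Q f) + 8 * ((h f)\<^sup>2 * (Y f)\<^sup>2) + 2 * (B l l f)\<^sup>2"
      by (simp add: power2_eq_square algebra_simps)
  qed
  also have "\<dots> = E (\<lambda>f. (Q f)\<^sup>2) + E (\<lambda>f. h f * (4 * Y f * Q f)) + E (\<lambda>f. g f * (2 * B l l f * Q f))
      + 8 * E (\<lambda>f. (h f)\<^sup>2 * (Y f)\<^sup>2) + 2 * E (\<lambda>f. (B l l f)\<^sup>2)"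
    by simp
  also have "E (\<lambda>f. h f * (4 * Y f * Q f)) = 0"
    unfolding h_def by (rule E_eta[OF l]) (simp add: ignores_def Y Q)
  also have "E (\<lambda>f. g f * (2 * B l l f * Q f)) = 0"
    unfolding g_def h_def by (rule E_eta_sq_centered[OF l]) (simp add: ignores_def Bl Q)
  also have "E (\<lambda>f. (h f)\<^sup>2 * (Y f)\<^sup>2) = p * (1 - p) * E (\<lambda>f. (Y f)\<^sup>2)"
    unfolding h_def by (rule E_eta_sq[OF l]) (simp add: ignores_def Y)
  also have "E (\<lambda>f. (Y f)\<^sup>2) = p * (1 - p) * (\<Sum>j\<in>T. E (\<lambda>f. (B j l f)\<^sup>2))"
    unfolding Y_def using insert.hyps insert.prems by (intro E_linear_form_sq) auto
  also have "p * (1 - p) * (p * (1 - p) * (\<Sum>j\<in>T. E (\<lambda>f. (B j l f)\<^sup>2))) \<le> (\<Sum>j\<in>T. E (\<lambda>f. (B j l f)\<^sup>2))"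
  proof -
    define S where "S = (\<Sum>j\<in>T. E (\<lambda>f. (B j l f)\<^sup>2))"
    have "S \<ge> 0" unfolding S_def by (intro sum_nonneg) auto
    hence "p * (1 - p) * (p * (1 - p) * S) \<le> 1 * (1 * S)"
      using p1p by (intro mult_mono) auto
    thus ?thesis by (simp add: S_def)
  qed
  also have "E (\<lambda>f. (Q f)\<^sup>2) \<le> 8 * (\<Sum>j\<in>T. \<Sum>k\<in>T. E (\<lambda>f. (B j k f)\<^sup>2))"
    unfolding Q_def using insert.prems by (intro insert.IH) auto
  finally have "E (\<lambda>f. ((\<Sum>j\<in>insert l T. \<Sum>k\<in>insert l T. B j k f * \<eta> (\<epsilon> j) f * \<eta> (\<epsilon> k) f) - p * (1 - p) * (\<Sum>j\<in>insert l T. B j j f))\<^sup>2)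
     \<le> 8 * (\<Sum>j\<in>T. \<Sum>k\<in>T. E (\<lambda>f. (B j k f)\<^sup>2)) + 8 * (\<Sum>j\<in>T. E (\<lambda>f. (B j l f)\<^sup>2)) + 2 * E (\<lambda>f. (B l l f)\<^sup>2)"
    by simp
  also have "\<dots> \<le> 8 * (\<Sum>j\<in>T. \<Sum>k\<in>T. E (\<lambda>f. (B j k f)\<^sup>2)) + 8 * (\<Sum>j\<in>T. E (\<lambda>f. (B j l f)\<^sup>2)) + 8 * E (\<lambda>f. (B l l f)\<^sup>2)
       + 8 * (\<Sum>k\<in>T. E (\<lambda>f. (B l k f)\<^sup>2))"
  proof -
    have "0 \<le> E (\<lambda>f. (B l l f)\<^sup>2)" "0 \<le> (\<Sum>k\<in>T. E (\<lambda>f. (B l k f)\<^sup>2))"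
      by (auto intro: sum_nonneg)
    thus ?thesis by linarith
  qed
  also have "\<dots> = 8 * (\<Sum>j\<in>insert l T. \<Sum>k\<in>insert l T. E (\<lambda>f. (B j k f)\<^sup>2))"
    using insert.hyps by (simp add: sum.distrib)
  finally show ?case .
qed

end

section \<open>The self-consistent equation of the semicircle law\<close>

text \<open>The Schur complement formula read from the larger index set: delete the index \<open>i\<close> from \<open>N\<close>.\<close>

lemma resolvent_diagonal_schur:
  assumes fin: "finite N" and i: "i \<in> N" and sym: "\<And>i j. X i j = X j i" and t: "t > 0"
    and G: "is_resolvent N X t G" and H: "is_resolvent (N - {i}) X t H"
  defines "D \<equiv> of_real (X i i) - \<i> * of_real t
      - (\<Sum>j\<in>N - {i}. \<Sum>k\<in>N - {i}. H j k * of_real (X i j) * of_real (X i k))"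
  shows "G i i = 1 / D" and "t \<le> cmod D"
    and "cmod ((\<Sum>j\<in>N. G j j) - (\<Sum>j\<in>N - {i}. H j j)) \<le> 1 / t"
proof -
  interpret e: resolvent_extension "N - {i}" X t H i
    using assms by unfold_locales auto
  have ins: "insert i (N - {i}) = N" using i by auto
  have eq: "G j k = e.G j k" if "j \<in> N" "k \<in> N" for j k
    using resolvent_unique[OF fin sym G, of e.G] e.is_resolvent_insert that unfolding ins by blast
  have D: "D = e.D"
    unfolding D_def e.D_def e.q_def e.w_def sum_distrib_left
    by (intro arg_cong2[where f = minus] refl sum.cong) (simp add: sym[of _ i] mult_ac)
  show "G i i = 1 / D" using eq[OF i i] by (simp add: D e.G_def)
  show "t \<le> cmod D" unfolding D by (rule e.cmod_D_ge)
  have "(\<Sum>j\<in>N. G j j) = (\<Sum>j\<in>N. e.G j j)" using eq by simp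
  thus "cmod ((\<Sum>j\<in>N. G j j) - (\<Sum>j\<in>N - {i}. H j j)) \<le> 1 / t"
    using e.cmod_trace_diff unfolding ins by simp
qed

lemma Im_trace_resolvent_nonneg:
  assumes "finite S" "\<And>i j. X i j = X j i" "t > 0" "is_resolvent S X t G"
  shows "0 \<le> Im (\<Sum>i\<in>S. G i i)"
proof -
  have "0 \<le> Im (G i i)" if "i \<in> S" for i
    using resolvent_diagonal_Im[OF assms that] assms(3) by (metis mult_nonneg_nonneg less_imp_le sum_nonneg zero_le_power2)
  thus ?thesis by (simp add: sum_nonneg)
qed

lemma cmod_trace_resolvent_le:
  assumes "finite S" "\<And>i j. X i j = X j i" "t > 0" "is_resolvent S X t G"
  shows "cmod (\<Sum>i\<in>S. G i i) \<le> real (card S) / t"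
proof -
  have "cmod (\<Sum>i\<in>S. G i i) \<le> (\<Sum>i\<in>S. 1 / t)"
    by (intro sum_norm_le cmod_resolvent_diagonal[OF assms])
  thus ?thesis by simp
qed

text \<open>The denominator of the Schur formula is \<open>- (i t + v s)\<close> up to three errors: the diagonal entry of
  \<open>X\<close>, the fluctuation of the quadratic form \<open>q\<close>, and the effect on the trace of deleting one index.
  Denominators are harmless, since both have modulus at least \<open>t\<close>.\<close>

lemma resolvent_diagonal_self_consistent:
  fixes N :: "'a set" and v t :: real
  assumes fin: "finite N" and i: "i \<in> N" and sym: "\<And>i j. X i j = X j i" and t: "t > 0" and v: "v \<ge> 0"
    and G: "is_resolvent N X t G" and H: "is_resolvent (N - {i}) X t H"
  defines "s \<equiv> (\<Sum>j\<in>N. G j j) / of_nat (card N)"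
  defines "q \<equiv> (\<Sum>j\<in>N - {i}. \<Sum>k\<in>N - {i}. H j k * of_real (X i j) * of_real (X i k))"
  shows "cmod (G i i + 1 / (\<i> * of_real t + of_real v * s))
    \<le> (\<bar>X i i\<bar> + cmod (q - of_real (v / card N) * (\<Sum>j\<in>N - {i}. H j j)) + v / (card N * t)) / t\<^sup>2"
proof -
  note S = resolvent_diagonal_schur[OF fin i sym t G H, folded q_def]
  define D where "D = of_real (X i i) - \<i> * of_real t - q"
  define F where "F = \<i> * of_real t + of_real v * s"
  let ?m = "real (card N)"
  have m: "?m > 0" using fin i by (auto simp: card_gt_0_iff)
  have "Im s \<ge> 0"
    using Im_trace_resolvent_nonneg[OF fin sym t G] m by (simp only: s_def Im_divide_of_nat) simp
  hence "t \<le> Im F" using v by (simp add: F_def)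
  hence F: "t \<le> cmod F" using abs_Im_le_cmod[of F] by linarith
  have D: "t \<le> cmod D" using S(2) by (simp add: D_def)
  have nz: "D \<noteq> 0" "F \<noteq> 0" using D F t by auto
  have "G i i + 1 / F = (D + F) / (D * F)"
    using nz by (simp add: S(1)[folded D_def] field_simps)
  hence "cmod (G i i + 1 / F) = cmod (D + F) / (cmod D * cmod F)"
    by (simp add: norm_divide norm_mult)
  also have "\<dots> \<le> cmod (D + F) / (t * t)"
    using D F t by (intro divide_left_mono mult_mono mult_pos_pos) auto
  also have "D + F = of_real (X i i) - (q - of_real (v / ?m) * (\<Sum>j\<in>N - {i}. H j j))
      + of_real (v / ?m) * ((\<Sum>j\<in>N. G j j) - (\<Sum>j\<in>N - {i}. H j j))"
    by (simp add: D_def F_def s_def algebra_simps)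
  also have "cmod \<dots> \<le> \<bar>X i i\<bar> + cmod (q - of_real (v / ?m) * (\<Sum>j\<in>N - {i}. H j j))
      + (v / ?m) * (1 / t)"
  proof -
    have "cmod (of_real (v / ?m) * ((\<Sum>j\<in>N. G j j) - (\<Sum>j\<in>N - {i}. H j j))) \<le> (v / ?m) * (1 / t)"
      unfolding norm_mult norm_of_real using S(3) v m by (intro mult_mono) auto
    thus ?thesis
      by (smt (verit) norm_triangle_ineq norm_triangle_ineq4 norm_of_real)
  qed
  finally show ?thesis using t by (simp add: F_def power2_eq_square divide_right_mono)
qed

text \<open>The Stieltjes transform of the semicircle law of variance \<open>v\<close>, at the point \<open>i t\<close>, is \<open>i\<close> times
  this number.\<close>

definition semicircle_stieltjes :: "real \<Rightarrow> real \<Rightarrow> real" where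
  "semicircle_stieltjes v t = (sqrt (t\<^sup>2 + 4 * v) - t) / (2 * v)"

lemma semicircle_stieltjes_eq:
  assumes "v > 0"
  shows "v * (semicircle_stieltjes v t)\<^sup>2 + t * semicircle_stieltjes v t = 1"
proof -
  define r where "r = sqrt (t\<^sup>2 + 4 * v)"
  have "r\<^sup>2 = t\<^sup>2 + 4 * v" using assms by (simp add: r_def)
  thus ?thesis
    using assms unfolding semicircle_stieltjes_def r_def[symmetric]
    by (simp add: field_simps power2_eq_square)
qed

lemma semicircle_stieltjes_pos:
  assumes "v > 0"
  shows "semicircle_stieltjes v t > 0"
proof -
  have "t < sqrt (t\<^sup>2 + 4 * v)" using assms by (intro real_less_rsqrt) auto
  thus ?thesis using assms by (simp add: semicircle_stieltjes_def)
qed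

text \<open>Put \<open>u\<close> for the value at \<open>t\<close> of the function above. The quadratic polynomial \<open>v s\<^sup>2 + i t s + 1\<close> has the
  roots \<open>i u\<close> and \<open>- i (t / v + u)\<close>. As \<open>s\<close> lies in the upper half plane, it keeps a distance of at least
  \<open>t / v\<close> from the second root, so a small value of the polynomial forces \<open>s\<close> to be near the first.\<close>

lemma self_consistent_stability:
  fixes s :: complex
  assumes t: "t > 0" and v: "v > 0" and Im: "0 \<le> Im s" and s: "cmod s \<le> 1 / t"
  shows "cmod (s - \<i> * of_real (semicircle_stieltjes v t))
    \<le> (t + v / t) / t * cmod (s + 1 / (\<i> * of_real t + of_real v * s))"
proof -
  define u where "u = semicircle_stieltjes v t"
  define F where "F = \<i> * of_real t + of_real v * s"
  have u: "v * u\<^sup>2 + t * u = 1" "u > 0"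
    using semicircle_stieltjes_eq[OF v] semicircle_stieltjes_pos[OF v] by (auto simp: u_def)
  have "t \<le> Im F" using v Im by (simp add: F_def)
  hence F0: "F \<noteq> 0" using t by auto
  have FB: "cmod F \<le> t + v / t"
  proof -
    have "cmod F \<le> cmod (\<i> * of_real t) + cmod (of_real v * s)" unfolding F_def by (rule norm_triangle_ineq)
    also have "\<dots> \<le> t + v / t" using t v mult_left_mono[OF s, of v] by (simp add: norm_mult)
    finally show ?thesis .
  qed
  have one: "complex_of_real v * (of_real u)\<^sup>2 + of_real t * of_real u = 1"
    using arg_cong[OF u(1), of complex_of_real] by simp
  have "(s - \<i> * of_real u) * (of_real v * s + \<i> * of_real (t + v * u))
     = of_real v * s\<^sup>2 + \<i> * of_real t * s + (complex_of_real v * (of_real u)\<^sup>2 + of_real t * of_real u)"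
    by (simp add: algebra_simps power2_eq_square)
  also have "\<dots> = (s + 1 / F) * F"
    unfolding one using F0 by (simp add: F_def field_simps power2_eq_square)
  finally have "cmod (s - \<i> * of_real u) * cmod (of_real v * s + \<i> * of_real (t + v * u)) = cmod (s + 1 / F) * cmod F"
    by (metis norm_mult)
  moreover have "t \<le> cmod (of_real v * s + \<i> * of_real (t + v * u))"
  proof -
    have "t \<le> Im (of_real v * s + \<i> * of_real (t + v * u))"
      using v Im u(2) by (simp add: add_nonneg_nonneg)
    also have "\<dots> \<le> cmod (of_real v * s + \<i> * of_real (t + v * u))"
      using abs_Im_le_cmod abs_le_D1 by blast
    finally show ?thesis .
  qed
  ultimately have "cmod (s - \<i> * of_real u) * t \<le> cmod (s + 1 / F) * (t + v / t)"
    by (smt (verit) FB mult_left_mono norm_ge_zero)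
  thus ?thesis using t by (simp add: u_def F_def field_simps)
qed

section \<open>The centered adjacency matrix of a random graph\<close>

lemma finite_all_edges: "finite (all_edges n)"
  by (rule finite_subset[of _ "Pow {1..n}"]) (auto simp: all_edges_def)

definition edge :: "nat \<Rightarrow> nat \<Rightarrow> nat set" where
  "edge i j = {Suc i, Suc j}"

lemma edge_commute: "edge i j = edge j i"
  by (auto simp: edge_def)

lemma edge_mem_all_edges: "i < n \<Longrightarrow> j < n \<Longrightarrow> edge i j \<in> all_edges n \<longleftrightarrow> i \<noteq> j"
  by (auto simp: edge_def all_edges_def card_insert_if)

lemma edge_eq_iff: "edge i j = edge k l \<longleftrightarrow> (i = k \<and> j = l) \<or> (i = l \<and> j = k)"
  by (auto simp: edge_def doubleton_eq_iff)

locale gnp =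
  fixes n :: nat and p :: real
  assumes n_pos: "0 < n" and p_pos: "0 < p" and p_less_1: "p < 1"
begin

sublocale bernoulli_product "all_edges n" p
  using finite_all_edges p_pos p_less_1 by unfold_locales auto

text \<open>The value that an entry of the ABC-matrix takes at an edge whose end points both have degree \<open>n p\<close>,
  up to lower order terms.\<close>

definition scaling :: real where "scaling = sqrt (2 / (real n * p))"

text \<open>The diagonal is chosen such that adding \<open>scaling * p\<close> to every entry gives exactly the scaled adjacency
  matrix, whose diagonal is zero.\<close>

definition centered :: "(nat set \<Rightarrow> bool) \<Rightarrow> nat \<Rightarrow> nat \<Rightarrow> real" where
  "centered f i j = (if i = j then - scaling * p else scaling * \<eta> (edge i j) f)"

text \<open>The variance of an off-diagonal entry of the centered matrix is \<open>v / n\<close>.\<close>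

abbreviation v :: real where "v \<equiv> 2 * (1 - p)"

lemma scaling_pos: "0 < scaling"
  using n_pos p_pos by (simp add: scaling_def)

lemma scaling_sq: "scaling\<^sup>2 = 2 / (real n * p)"
  using n_pos p_pos by (simp add: scaling_def)

lemma centered_sym: "centered f i j = centered f j i"
  by (simp add: centered_def edge_commute)

lemma centered_ignores:
  assumes "j \<noteq> i" "k \<noteq> i"
  shows "centered (f(edge i l := b)) j k = centered f j k"
  using assms by (auto simp: centered_def \<eta>_def edge_eq_iff)

text \<open>The resolvent of the matrix without index \<open>i\<close> ignores the edges at \<open>i\<close>, so the bound for quadratic
  forms applies to its real and its imaginary part.\<close>

lemma E_quadratic_form_concentration:
  assumes i: "i < n" and t: "t > 0"
  defines "S \<equiv> {..<n} - {i}"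
  defines "H \<equiv> \<lambda>f. resolvent S (centered f) t"
  shows "E (\<lambda>f. cmod ((\<Sum>j\<in>S. \<Sum>k\<in>S. H f j k * of_real (centered f i j) * of_real (centered f i k))
      - of_real (v / n) * (\<Sum>j\<in>S. H f j j))) \<le> 6 / (p * t * sqrt n)"
proof -
  have fin: "finite S" by (simp add: S_def)
  have H: "is_resolvent S (centered f) t (H f)" for f
    unfolding H_def using fin centered_sym t by (rule is_resolvent_resolvent)
  have H_sym: "H f j k = H f k j" if "j \<in> S" "k \<in> S" for f j k
    using resolvent_transpose_unique[OF fin centered_sym H H that] .
  have H_ignores: "ignores (edge i l) H" for l
    unfolding ignores_def H_def
    by (intro allI resolvent_cong) (auto simp: S_def centered_ignores)
  define Q where "Q B f = (\<Sum>j\<in>S. \<Sum>k\<in>S. B j k f * \<eta> (edge i j) f * \<eta> (edge i k) f)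
      - p * (1 - p) * (\<Sum>j\<in>S. B j j f)" for B f
  let ?R = "\<lambda>j k f. Re (H f j k)" and ?I = "\<lambda>j k f. Im (H f j k)"
  let ?q = "\<lambda>f. (\<Sum>j\<in>S. \<Sum>k\<in>S. H f j k * of_real (centered f i j) * of_real (centered f i k))
      - of_real (v / n) * (\<Sum>j\<in>S. H f j j)"
  have centered: "centered f i j = scaling * \<eta> (edge i j) f" if "j \<in> S" for f j
    using that by (simp add: centered_def S_def)
  have vn: "v / n = scaling\<^sup>2 * (p * (1 - p))"
    using n_pos p_pos by (simp add: scaling_sq)
  have Re: "Re (?q f) = scaling\<^sup>2 * Q ?R f" for f
    unfolding vn Q_def right_diff_distrib[of "scaling\<^sup>2"] sum_distrib_left minus_complex.simps Re_sum
    by (intro arg_cong2[where f = minus] sum.cong refl) (simp_all add: centered power2_eq_square mult_ac)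
  have Im: "Im (?q f) = scaling\<^sup>2 * Q ?I f" for f
    unfolding vn Q_def right_diff_distrib[of "scaling\<^sup>2"] sum_distrib_left minus_complex.simps Im_sum
    by (intro arg_cong2[where f = minus] sum.cong refl) (simp_all add: centered power2_eq_square mult_ac)
  have edges: "inj_on (edge i) S" "edge i ` S \<subseteq> all_edges n"
    using i by (auto simp: inj_on_def edge_eq_iff edge_mem_all_edges S_def)
  have EQ: "E (\<lambda>f. (Q B f)\<^sup>2) \<le> 8 * (\<Sum>j\<in>S. \<Sum>k\<in>S. E (\<lambda>f. (B j k f)\<^sup>2))"
    if "\<And>j k f. B j k f = g (H f j k)" for B g
    unfolding Q_def
    using that H_sym ignoresD[OF H_ignores]
    by (intro E_quadratic_form_sq fin edges) (auto simp: ignores_def)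
  have "E (\<lambda>f. (cmod (?q f))\<^sup>2) = E (\<lambda>f. scaling^4 * (Q ?R f)\<^sup>2 + scaling^4 * (Q ?I f)\<^sup>2)"
    unfolding cmod_power2 Re Im by (simp add: power_mult_distrib flip: power_mult)
  also have "\<dots> = scaling^4 * (E (\<lambda>f. (Q ?R f)\<^sup>2) + E (\<lambda>f. (Q ?I f)\<^sup>2))"
    by (simp add: distrib_left)
  also have "\<dots> \<le> scaling^4 * (8 * (\<Sum>j\<in>S. \<Sum>k\<in>S. E (\<lambda>f. (?R j k f)\<^sup>2)) + 8 * (\<Sum>j\<in>S. \<Sum>k\<in>S. E (\<lambda>f. (?I j k f)\<^sup>2)))"
    using EQ[of ?R Re] EQ[of ?I Im] by (intro mult_left_mono add_mono) auto
  also have "\<dots> = 8 * scaling^4 * E (\<lambda>f. \<Sum>k\<in>S. \<Sum>j\<in>S. (cmod (H f j k))\<^sup>2)"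
    unfolding cmod_power2 by (subst sum.swap) (simp add: sum.distrib algebra_simps)
  also have "\<dots> \<le> 8 * scaling^4 * E (\<lambda>f. n / t\<^sup>2)"
  proof (intro mult_left_mono E_mono)
    fix f
    have "(\<Sum>k\<in>S. \<Sum>j\<in>S. (cmod (H f j k))\<^sup>2) \<le> (\<Sum>k\<in>S. 1 / t\<^sup>2)"
      by (intro sum_mono resolvent_column_norm[OF fin centered_sym t H])
    also have "\<dots> \<le> (\<Sum>k\<in>{..<n}. 1 / t\<^sup>2)" by (intro sum_mono2) (auto simp: S_def)
    finally show "(\<Sum>k\<in>S. \<Sum>j\<in>S. (cmod (H f j k))\<^sup>2) \<le> n / t\<^sup>2" by simp
  qed (simp add: scaling_pos less_imp_le)
  also have "\<dots> = 32 / (n * p\<^sup>2 * t\<^sup>2)"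
  proof -
    have "scaling^4 = (2 / (n * p))\<^sup>2" unfolding scaling_sq[symmetric] by (simp flip: power_mult)
    thus ?thesis using n_pos p_pos t by (simp add: field_simps power2_eq_square)
  qed
  also have "\<dots> \<le> (6 / (p * t * sqrt n))\<^sup>2"
    using n_pos p_pos t by (simp add: power_mult_distrib power_divide divide_right_mono mult_ac)
  finally have "E (\<lambda>f. (cmod (?q f))\<^sup>2) \<le> (6 / (p * t * sqrt n))\<^sup>2" .
  hence "sqrt (E (\<lambda>f. (cmod (?q f))\<^sup>2)) \<le> 6 / (p * t * sqrt n)"
    using p_pos t by (intro real_le_lsqrt) auto
  moreover have "E (\<lambda>f. cmod (?q f)) \<le> sqrt (E (\<lambda>f. (cmod (?q f))\<^sup>2))"
    using E_abs_le_sqrt[of "\<lambda>f. cmod (?q f)"] by simp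
  ultimately show ?thesis by linarith
qed

text \<open>The normalized trace of the resolvent, that is, the Stieltjes transform of the empirical spectral
  distribution at \<open>i t\<close>.\<close>

definition stieltjes :: "real \<Rightarrow> (nat set \<Rightarrow> bool) \<Rightarrow> complex" where
  "stieltjes t f = (\<Sum>j<n. resolvent {..<n} (centered f) t j j) / of_nat n"

text \<open>Average the self-consistent equation over the diagonal. The equation holds for the random trace
  itself, up to an error that is small in mean, so its stability applies to each outcome separately.\<close>

lemma E_self_consistent:
  assumes t: "t > 0"
  shows "E (\<lambda>f. cmod (stieltjes t f + 1 / (\<i> * of_real t + of_real v * stieltjes t f)))
     \<le> (2 + 6 / (p * t) + 2 / t) / t\<^sup>2 / sqrt n"
proof -
  define G where "G f = resolvent {..<n} (centered f) t" for f
  define H where "H i f = resolvent ({..<n} - {i}) (centered f) t" for i f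
  define F where "F f = \<i> * of_real t + of_real v * stieltjes t f" for f
  define q where "q i f = cmod ((\<Sum>j\<in>{..<n} - {i}. \<Sum>k\<in>{..<n} - {i}. H i f j k * of_real (centered f i j) * of_real (centered f i k))
      - of_real (v / n) * (\<Sum>j\<in>{..<n} - {i}. H i f j j))" for i f
  have G: "is_resolvent {..<n} (centered f) t (G f)" for f
    unfolding G_def by (rule is_resolvent_resolvent[OF finite_lessThan centered_sym t])
  have H: "is_resolvent ({..<n} - {i}) (centered f) t (H i f)" for i f
    unfolding H_def by (rule is_resolvent_resolvent[OF _ centered_sym t]) simp
  have v: "0 \<le> v" using p_less_1 by simp
  have stieltjes: "stieltjes t f = (\<Sum>j\<in>{..<n}. G f j j) / of_nat (card {..<n})" for f
    by (simp add: stieltjes_def G_def)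
  have "E (\<lambda>f. cmod (stieltjes t f + 1 / F f)) \<le> E (\<lambda>f. (\<Sum>i<n. (scaling * p + q i f + v / (n * t)) / t\<^sup>2) / n)"
  proof (rule E_mono)
    fix f
    have "stieltjes t f + 1 / F f = (\<Sum>i<n. G f i i + 1 / F f) / of_nat n"
      using n_pos by (simp add: sum.distrib stieltjes add_divide_distrib)
    hence "cmod (stieltjes t f + 1 / F f) = cmod (\<Sum>i<n. G f i i + 1 / F f) / n"
      by (simp add: norm_divide)
    also have "\<dots> \<le> (\<Sum>i<n. (scaling * p + q i f + v / (n * t)) / t\<^sup>2) / n"
    proof (intro divide_right_mono sum_norm_le)
      fix i assume i: "i \<in> {..<n}"
      have "\<bar>centered f i i\<bar> = scaling * p" using scaling_pos p_pos by (simp add: centered_def abs_mult)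
      thus "cmod (G f i i + 1 / F f) \<le> (scaling * p + q i f + v / (n * t)) / t\<^sup>2"
        using resolvent_diagonal_self_consistent[OF finite_lessThan i centered_sym t v G H, of f]
        unfolding F_def stieltjes q_def by simp
    qed simp
    finally show "cmod (stieltjes t f + 1 / F f) \<le> (\<Sum>i<n. (scaling * p + q i f + v / (n * t)) / t\<^sup>2) / n" .
  qed
  also have "\<dots> = (\<Sum>i<n. (scaling * p + E (q i) + v / (n * t)) / t\<^sup>2) / n"
    by simp
  also have "\<dots> \<le> (\<Sum>i<n. (2 / sqrt n + 6 / (p * t * sqrt n) + 2 / (t * sqrt n)) / t\<^sup>2) / n"
  proof (intro divide_right_mono sum_mono add_mono)
    fix i assume "i \<in> {..<n}"
    thus "E (q i) \<le> 6 / (p * t * sqrt n)"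
      unfolding q_def H_def using E_quadratic_form_concentration[of i t] t by simp
    have "(scaling * p)\<^sup>2 = 2 * p / n"
      unfolding power_mult_distrib scaling_sq using p_pos by (simp add: power2_eq_square)
    also have "\<dots> \<le> (2 / sqrt n)\<^sup>2"
      using p_less_1 by (simp add: power_divide divide_right_mono)
    finally show "scaling * p \<le> 2 / sqrt n" by (rule power2_le_imp_le) simp
    have "sqrt n \<le> n" using n_pos by (intro real_le_lsqrt) (auto simp: power2_eq_square)
    hence "v / (n * t) \<le> 2 / (sqrt n * t)"
      using p_pos p_less_1 n_pos t by (intro frac_le mult_right_mono) auto
    thus "v / (n * t) \<le> 2 / (t * sqrt n)" by (simp add: mult.commute)
  qed auto
  also have "\<dots> = (2 / sqrt n + 6 / (p * t * sqrt n) + 2 / (t * sqrt n)) / t\<^sup>2"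
    using n_pos by simp
  also have "\<dots> = (2 + 6 / (p * t) + 2 / t) / t\<^sup>2 / sqrt n"
    by (simp add: add_divide_distrib mult_ac)
  finally show ?thesis by (simp add: F_def)
qed

text \<open>The semicircle law for the centered matrix, with a rate, on the imaginary axis.\<close>

lemma E_stieltjes_convergence:
  assumes t: "t > 0"
  shows "E (\<lambda>f. cmod (stieltjes t f - \<i> * of_real (semicircle_stieltjes v t)))
     \<le> (t + v / t) / t * ((2 + 6 / (p * t) + 2 / t) / t\<^sup>2) / sqrt n"
proof -
  have v: "v > 0" using p_less_1 by simp
  have G: "is_resolvent {..<n} (centered f) t (resolvent {..<n} (centered f) t)" for f
    by (rule is_resolvent_resolvent[OF finite_lessThan centered_sym t])
  have "E (\<lambda>f. cmod (stieltjes t f - \<i> * of_real (semicircle_stieltjes v t)))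
      \<le> E (\<lambda>f. (t + v / t) / t * cmod (stieltjes t f + 1 / (\<i> * of_real t + of_real v * stieltjes t f)))"
  proof (rule E_mono, rule self_consistent_stability[OF t v])
    fix f
    show "0 \<le> Im (stieltjes t f)"
      using Im_trace_resolvent_nonneg[OF finite_lessThan centered_sym t G] by (simp only: stieltjes_def Im_divide_of_nat) simp
    show "cmod (stieltjes t f) \<le> 1 / t"
      using cmod_trace_resolvent_le[OF finite_lessThan centered_sym t G, of f] n_pos by (simp add: stieltjes_def norm_divide field_simps)
  qed
  also have "\<dots> = (t + v / t) / t * E (\<lambda>f. cmod (stieltjes t f + 1 / (\<i> * of_real t + of_real v * stieltjes t f)))"
    by simp
  also have "\<dots> \<le> (t + v / t) / t * ((2 + 6 / (p * t) + 2 / t) / t\<^sup>2 / sqrt n)"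
    using t v by (intro mult_left_mono E_self_consistent) auto
  finally show ?thesis by simp
qed

end

section \<open>From the adjacency matrix to the ABC-matrix\<close>

lemma sqrt_diff_sq_le:
  assumes "0 \<le> x" "0 \<le> y"
  shows "(sqrt x - sqrt y)\<^sup>2 \<le> \<bar>x - y\<bar>"
proof -
  have "(sqrt x - sqrt y)\<^sup>2 = \<bar>sqrt x - sqrt y\<bar> * \<bar>sqrt x - sqrt y\<bar>"
    by (simp add: power2_eq_square flip: abs_mult)
  also have "\<dots> \<le> \<bar>sqrt x - sqrt y\<bar> * (sqrt x + sqrt y)"
    using assms by (intro mult_left_mono) (auto simp: abs_le_iff)
  also have "\<dots> = \<bar>(sqrt x - sqrt y) * (sqrt x + sqrt y)\<bar>"
    using assms by (simp add: abs_mult)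
  also have "(sqrt x - sqrt y) * (sqrt x + sqrt y) = x - y"
    using assms by (simp add: algebra_simps)
  finally show ?thesis .
qed

lemma Im_sum_mset: "Im (\<Sum>x\<in>#A. g x) = (\<Sum>x\<in>#A. Im (g x))"
  by (induction A) auto

context gnp
begin

definition edges :: "(nat set \<Rightarrow> bool) \<Rightarrow> nat set set" where
  "edges f = {e \<in> all_edges n. f e}"

definition adj :: "(nat set \<Rightarrow> bool) \<Rightarrow> nat \<Rightarrow> nat \<Rightarrow> bool" where
  "adj f i j \<longleftrightarrow> i < n \<and> j < n \<and> i \<noteq> j \<and> f (edge i j)"

definition deg :: "(nat set \<Rightarrow> bool) \<Rightarrow> nat \<Rightarrow> real" where
  "deg f i = real (vertex_degree (edges f) (Suc i))"

definition ABC :: "(nat set \<Rightarrow> bool) \<Rightarrow> nat \<Rightarrow> nat \<Rightarrow> real" where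
  "ABC f i j = (if adj f i j then sqrt (deg f i + deg f j - 2) / sqrt (deg f i * deg f j) else 0)"

lemma adj_commute: "adj f i j = adj f j i"
  by (auto simp: adj_def edge_commute)

lemma ABC_sym: "ABC f i j = ABC f j i"
  by (simp add: ABC_def adj_commute[of f i j] add.commute mult.commute)

lemma edge_in_edges_iff: "i < n \<Longrightarrow> j < n \<Longrightarrow> {Suc i, Suc j} \<in> edges f \<longleftrightarrow> adj f i j"
  using edge_mem_all_edges[of i n j] by (auto simp: edges_def adj_def edge_def)

lemma ABC_matrix_entry: "i < n \<Longrightarrow> j < n \<Longrightarrow> ABC_matrix n (edges f) $$ (i, j) = ABC f i j"
  by (simp add: ABC_matrix_def ABC_def deg_def edge_in_edges_iff)

text \<open>The edges at the vertex \<open>Suc i\<close> correspond to the neighbours of the index \<open>i\<close>.\<close>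

lemma deg_eq_sum:
  assumes i: "i < n"
  shows "deg f i = (\<Sum>j<n. of_bool (adj f i j))"
proof -
  have "bij_betw (edge i) {j\<in>{..<n}. adj f i j} {e \<in> edges f. Suc i \<in> e}"
    unfolding bij_betw_def
  proof
    show "inj_on (edge i) {j\<in>{..<n}. adj f i j}"
      by (auto simp: inj_on_def edge_eq_iff)
    show "edge i ` {j\<in>{..<n}. adj f i j} = {e \<in> edges f. Suc i \<in> e}"
    proof (intro equalityI subsetI)
      fix e assume "e \<in> edge i ` {j\<in>{..<n}. adj f i j}"
      thus "e \<in> {e \<in> edges f. Suc i \<in> e}"
        using i edge_in_edges_iff by (auto simp: edge_def)
    next
      fix e assume e: "e \<in> {e \<in> edges f. Suc i \<in> e}"
      hence "card e = 2" "e \<subseteq> {1..n}" by (auto simp: edges_def all_edges_def)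
      then obtain x z where xz: "e = {x, z}" "x \<in> {1..n}" "z \<in> {1..n}"
        by (auto simp: card_2_iff)
      define y where "y = (if x = Suc i then z else x)"
      have y: "e = {Suc i, y}" "y \<in> {1..n}"
        using e xz by (auto simp: y_def)
      then obtain j where j: "y = Suc j" "j < n" by (cases y) auto
      hence "adj f i j" using e y i edge_in_edges_iff by auto
      thus "e \<in> edge i ` {j\<in>{..<n}. adj f i j}" using y j by (auto simp: edge_def)
    qed
  qed
  hence "card {e \<in> edges f. Suc i \<in> e} = card {j\<in>{..<n}. adj f i j}"
    by (simp add: bij_betw_same_card)
  thus ?thesis by (simp add: deg_def vertex_degree_def of_bool_def sum.If_cases Int_def)
qed

lemma deg_ge_1:
  assumes "adj f i j"
  shows "1 \<le> deg f i"
proof -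
  have "of_bool (adj f i j) \<le> (\<Sum>j<n. of_bool (adj f i j) :: real)"
    using assms by (intro member_le_sum) (auto simp: adj_def)
  moreover have "i < n" using assms by (simp add: adj_def)
  ultimately show ?thesis using assms by (simp add: deg_eq_sum)
qed

text \<open>Double counting: the index \<open>i\<close> occurs in \<open>deg f i\<close> ordered adjacent pairs on either side.\<close>

lemma sum_over_adjacent:
  fixes g :: "nat \<Rightarrow> real"
  shows "(\<Sum>i<n. \<Sum>j<n. of_bool (adj f i j) * (g i + g j)) = 2 * (\<Sum>i<n. deg f i * g i)"
proof -
  have 1: "(\<Sum>i<n. \<Sum>j<n. of_bool (adj f i j) * g i) = (\<Sum>i<n. deg f i * g i)"
    by (simp add: deg_eq_sum sum_distrib_right)
  have "(\<Sum>i<n. \<Sum>j<n. of_bool (adj f i j) * g j) = (\<Sum>j<n. \<Sum>i<n. of_bool (adj f j i) * g j)"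
    by (subst sum.swap) (simp add: adj_commute)
  thus ?thesis using 1 by (simp add: distrib_left sum.distrib)
qed

lemma ABC_sq:
  assumes "adj f i j"
  shows "ABC f i j = sqrt (1 / deg f i + 1 / deg f j - 2 / (deg f i * deg f j))"
    and "0 \<le> 1 / deg f i + 1 / deg f j - 2 / (deg f i * deg f j)"
proof -
  have d: "1 \<le> deg f i" "1 \<le> deg f j"
    using assms deg_ge_1 adj_commute by blast+
  have eq: "1 / deg f i + 1 / deg f j - 2 / (deg f i * deg f j) = (deg f i + deg f j - 2) / (deg f i * deg f j)"
    using d by (simp add: field_simps)
  show "0 \<le> 1 / deg f i + 1 / deg f j - 2 / (deg f i * deg f j)"
    unfolding eq using d by simp
  show "ABC f i j = sqrt (1 / deg f i + 1 / deg f j - 2 / (deg f i * deg f j))"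
    unfolding eq using assms by (simp add: ABC_def real_sqrt_divide)
qed

text \<open>A squared entry is at most \<open>1 / deg i + 1 / deg j\<close>, and by double counting every non-isolated vertex
  contributes \<open>2\<close> to the sum of these bounds. Hence the second moment of the spectrum stays bounded,
  which controls the integral for the absolute value at large \<open>t\<close>.\<close>

lemma sum_ABC_sq_le: "(\<Sum>i<n. \<Sum>j<n. (ABC f i j)\<^sup>2) \<le> 2 * n"
proof -
  have "(\<Sum>i<n. \<Sum>j<n. (ABC f i j)\<^sup>2) \<le> (\<Sum>i<n. \<Sum>j<n. of_bool (adj f i j) * (1 / deg f i + 1 / deg f j))"
  proof (intro sum_mono)
    fix i j
    show "(ABC f i j)\<^sup>2 \<le> of_bool (adj f i j) * (1 / deg f i + 1 / deg f j)"
    proof (cases "adj f i j")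
      case True
      hence "1 \<le> deg f i" "1 \<le> deg f j" using deg_ge_1 adj_commute by blast+
      thus ?thesis using ABC_sq[OF True] True by simp
    qed (simp add: ABC_def)
  qed
  also have "\<dots> = 2 * (\<Sum>i<n. deg f i * (1 / deg f i))" by (rule sum_over_adjacent)
  also have "\<dots> \<le> 2 * (\<Sum>i<n. 1)" by (intro mult_left_mono sum_mono) auto
  finally show ?thesis by simp
qed

text \<open>With \<open>r = 1 / (n p)\<close>: either the degree \<open>d\<close> is at least half its typical value, or its relative
  deviation is at least \<open>1 / 2\<close>. This bounds inverse degrees by quantities with a known mean.\<close>

lemma inverse_degree_le:
  fixes d r :: real
  assumes "1 \<le> d" "0 \<le> r"
  shows "1 / d \<le> 2 * r + 2 * \<bar>1 - d * r\<bar>"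
proof (cases "1 / 2 \<le> d * r")
  case True
  hence "1 / d \<le> 2 * r" using assms by (simp add: field_simps)
  thus ?thesis by (intro add_increasing2) auto
next
  case False
  hence "1 \<le> 2 * \<bar>1 - d * r\<bar>" by simp
  moreover have "1 / d \<le> 1" using assms by simp
  ultimately show ?thesis using assms by linarith
qed

text \<open>By \<open>(sqrt x - sqrt y)\<^sup>2 \<le> \<bar>x - y\<bar>\<close> it suffices to compare squared entries, and these are sums of
  contributions of the two end points. Double counting multiplies the contribution \<open>\<bar>1 / d - r\<bar>\<close> of a
  vertex by its degree \<open>d\<close>, which turns it into the relative deviation \<open>\<bar>1 - d r\<bar>\<close>. Thus only the average
  deviation of the degrees enters.\<close>

lemma sum_ABC_minus_scaled_adjacency_sq:
  "(\<Sum>i<n. \<Sum>j<n. (ABC f i j - scaling * of_bool (adj f i j))\<^sup>2)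
    \<le> (\<Sum>i<n. 6 * \<bar>1 - deg f i * (1 / (n * p))\<bar> + 4 * (1 / (n * p)))"
proof -
  define r where "r = 1 / (n * p)"
  have r: "0 < r" using n_pos p_pos by (simp add: r_def)
  define g where "g i = \<bar>1 / deg f i - r\<bar> + 1 / (deg f i)\<^sup>2" for i
  have "(\<Sum>i<n. \<Sum>j<n. (ABC f i j - scaling * of_bool (adj f i j))\<^sup>2)
     \<le> (\<Sum>i<n. \<Sum>j<n. of_bool (adj f i j) * (g i + g j))"
  proof (intro sum_mono)
    fix i j
    show "(ABC f i j - scaling * of_bool (adj f i j))\<^sup>2 \<le> of_bool (adj f i j) * (g i + g j)"
    proof (cases "adj f i j")
      case True
      have scaling: "scaling = sqrt (2 * r)" by (simp add: scaling_def r_def)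
      define x y where "x = 1 / deg f i" and "y = 1 / deg f j"
      have xy: "2 / (deg f i * deg f j) = 2 * (x * y)" by (simp add: x_def y_def)
      have pos: "0 \<le> x" "0 \<le> y" by (simp_all add: x_def y_def deg_def)
      have "(ABC f i j - scaling)\<^sup>2 \<le> \<bar>(x + y - 2 * (x * y)) - 2 * r\<bar>"
        using ABC_sq[OF True] r unfolding scaling xy x_def[symmetric] y_def[symmetric]
        by (simp only:) (intro sqrt_diff_sq_le, auto)
      also have "\<dots> \<le> \<bar>x - r\<bar> + \<bar>y - r\<bar> + 2 * (x * y)"
        using pos by (smt (verit) mult_nonneg_nonneg)
      also have "2 * (x * y) \<le> x\<^sup>2 + y\<^sup>2"
        using sum_squares_bound[of x y] by simp
      finally show ?thesis using True by (simp add: g_def x_def y_def power_one_over)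
    qed (simp add: ABC_def)
  qed
  also have "\<dots> = 2 * (\<Sum>i<n. deg f i * g i)" by (rule sum_over_adjacent)
  also have "\<dots> \<le> 2 * (\<Sum>i<n. 3 * \<bar>1 - deg f i * r\<bar> + 2 * r)"
  proof (intro mult_left_mono sum_mono)
    fix i
    show "deg f i * g i \<le> 3 * \<bar>1 - deg f i * r\<bar> + 2 * r"
    proof (cases "deg f i = 0")
      case True
      thus ?thesis using r by simp
    next
      case False
      hence d: "1 \<le> deg f i" by (simp add: deg_def)
      have "deg f i * \<bar>1 / deg f i - r\<bar> = \<bar>deg f i * (1 / deg f i - r)\<bar>"
        using d by (simp add: abs_mult)
      also have "deg f i * (1 / deg f i - r) = 1 - deg f i * r" using d by (simp add: field_simps)
      finally have "deg f i * g i = \<bar>1 - deg f i * r\<bar> + 1 / deg f i"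
        using d by (simp add: g_def distrib_left power2_eq_square)
      moreover have "y \<le> 3 * x + 2 * r" if "y = x + z" "z \<le> 2 * r + 2 * x" for x y z
        using that by linarith
      ultimately show ?thesis using inverse_degree_le[OF d less_imp_le[OF r]] by blast
    qed
  qed simp
  also have "\<dots> = (\<Sum>i<n. 6 * \<bar>1 - deg f i * r\<bar> + 4 * r)"
    by (simp add: sum_distrib_left sum.distrib)
  finally show ?thesis by (simp only: r_def)
qed

lemma E_degree_deviation:
  assumes i: "i < n"
  shows "E (\<lambda>f. \<bar>1 - deg f i * (1 / (n * p))\<bar>) \<le> (1 + sqrt n) * (1 / (n * p))"
proof -
  define S where "S = {..<n} - {i}"
  define r where "r = 1 / (n * p)"
  have r: "0 < r" using n_pos p_pos by (simp add: r_def)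
  define L where "L f = (\<Sum>j\<in>S. 1 * \<eta> (edge i j) f)" for f
  have deg: "deg f i = L f + (n - 1) * p" for f
  proof -
    have "deg f i = (\<Sum>j\<in>S. of_bool (adj f i j))"
      unfolding deg_eq_sum[OF i] S_def using i
      by (subst sum.remove[of _ i]) (auto simp: adj_def)
    also have "\<dots> = (\<Sum>j\<in>S. \<eta> (edge i j) f + p)"
      using i by (intro sum.cong) (auto simp: S_def adj_def \<eta>_def)
    finally show ?thesis using i by (simp add: L_def sum.distrib S_def)
  qed
  have "E (\<lambda>f. (L f)\<^sup>2) = p * (1 - p) * (\<Sum>j\<in>S. E (\<lambda>f. 1\<^sup>2))"
    unfolding L_def using i
    by (intro E_linear_form_sq) (auto simp: S_def inj_on_def edge_eq_iff edge_mem_all_edges ignores_def)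
  also have "\<dots> \<le> 1 * (\<Sum>j\<in>{..<n}. 1)"
    using p1p by (intro mult_mono) (auto simp: S_def intro: order_trans[OF card_Diff1_le])
  finally have "E (\<lambda>f. (L f)\<^sup>2) \<le> n" by simp
  hence L: "E (\<lambda>f. \<bar>L f\<bar>) \<le> sqrt n"
    using E_abs_le_sqrt[of L] real_sqrt_le_mono order_trans by blast
  have "\<bar>1 - deg f i * r\<bar> \<le> r + r * \<bar>L f\<bar>" for f
  proof -
    have "1 - deg f i * r = r * p - r * L f"
      using n_pos p_pos by (simp add: deg r_def of_nat_diff field_simps)
    moreover have "\<bar>r * L f\<bar> = r * \<bar>L f\<bar>" using r by (simp add: abs_mult)
    moreover have "r * p \<le> r" "0 \<le> r * p" using r p_less_1 p_pos by auto
    ultimately show ?thesis by linarith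
  qed
  hence "E (\<lambda>f. \<bar>1 - deg f i * r\<bar>) \<le> E (\<lambda>f. r + r * \<bar>L f\<bar>)" by (rule E_mono)
  also have "\<dots> = r + r * E (\<lambda>f. \<bar>L f\<bar>)" by simp
  also have "\<dots> \<le> r + r * sqrt n" using L r by (intro add_left_mono mult_left_mono) auto
  finally show ?thesis by (simp only: r_def) (simp add: algebra_simps add_divide_distrib)
qed

text \<open>Divided by \<open>sqrt n\<close>, as in the perturbation bound for normalized traces, this tends to zero: the sum
  of squares has expectation of order \<open>sqrt n\<close>, because the relative deviation of a degree is of order
  \<open>1 / sqrt n\<close>.\<close>

lemma E_frobenius_diff:
  "E (\<lambda>f. sqrt (\<Sum>i<n. \<Sum>j<n. (ABC f i j - scaling * of_bool (adj f i j))\<^sup>2)) \<le> sqrt (16 * sqrt n / p)"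
proof -
  let ?D = "\<lambda>f. \<Sum>i<n. \<Sum>j<n. (ABC f i j - scaling * of_bool (adj f i j))\<^sup>2"
  have D0: "0 \<le> ?D f" for f by (intro sum_nonneg) auto
  define r where "r = 1 / (n * p)"
  have r: "0 < r" using n_pos p_pos by (simp add: r_def)
  have "E ?D \<le> E (\<lambda>f. \<Sum>i<n. 6 * \<bar>1 - deg f i * r\<bar> + 4 * r)"
    unfolding r_def by (intro E_mono sum_ABC_minus_scaled_adjacency_sq)
  also have "\<dots> = (\<Sum>i<n. 6 * E (\<lambda>f. \<bar>1 - deg f i * r\<bar>) + 4 * r)" by simp
  also have "\<dots> \<le> (\<Sum>i<n. 6 * ((1 + sqrt n) * r) + 4 * r)"
    unfolding r_def by (intro sum_mono add_mono mult_left_mono E_degree_deviation) auto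
  also have "\<dots> = (10 + 6 * sqrt n) * (n * r)" by (simp add: algebra_simps)
  also have "\<dots> \<le> (16 * sqrt n) * (n * r)"
    using n_pos r by (intro mult_right_mono) auto
  also have "\<dots> = 16 * sqrt n / p" using n_pos by (simp add: r_def)
  finally have "sqrt (E ?D) \<le> sqrt (16 * sqrt n / p)" by (rule real_sqrt_le_mono)
  moreover have "E (\<lambda>f. \<bar>sqrt (?D f)\<bar>) \<le> sqrt (E (\<lambda>f. (sqrt (?D f))\<^sup>2))" by (rule E_abs_le_sqrt)
  moreover have "\<bar>sqrt (?D f)\<bar> = sqrt (?D f)" "(sqrt (?D f))\<^sup>2 = ?D f" for f
    using D0 by simp_all
  ultimately show ?thesis by (simp only:)
qed

definition eigenvalues :: "(nat set \<Rightarrow> bool) \<Rightarrow> real multiset" where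
  "eigenvalues f = eigenvalues_mset (ABC_matrix n (edges f))"

lemma size_eigenvalues: "size (eigenvalues f) = n"
  unfolding eigenvalues_def by (rule size_eigenvalues_symmetric[OF ABC_matrix_carrier transpose_ABC_matrix])

lemma sum_eigenvalues_sq_le: "(\<Sum>x\<in>#eigenvalues f. x\<^sup>2) \<le> 2 * n"
  unfolding eigenvalues_def sum_eigenvalues_squared[OF ABC_matrix_carrier transpose_ABC_matrix]
  using sum_ABC_sq_le[of f] by (simp add: ABC_matrix_entry)

lemma Im_trace_resolvent_ABC:
  assumes t: "t > 0"
  shows "Im (\<Sum>i<n. resolvent {..<n} (ABC f) t i i) = (\<Sum>x\<in>#eigenvalues f. t / (x\<^sup>2 + t\<^sup>2))"
proof -
  let ?A = "ABC_matrix n (edges f)"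
  have "resolvent {..<n} (ABC f) t = resolvent {..<n} (\<lambda>i j. ?A $$ (i, j)) t"
    by (rule resolvent_cong) (simp add: ABC_matrix_entry)
  moreover have "is_resolvent {..<n} (ABC f) t (resolvent {..<n} (ABC f) t)"
    by (rule is_resolvent_resolvent[OF finite_lessThan ABC_sym t])
  ultimately have "is_resolvent {..<n} (\<lambda>i j. ?A $$ (i, j)) t (resolvent {..<n} (ABC f) t)"
    by (simp add: is_resolvent_def ABC_matrix_entry)
  hence "(\<Sum>i<n. resolvent {..<n} (ABC f) t i i) = (\<Sum>x\<in>#eigenvalues f. 1 / (complex_of_real x - \<i> * of_real t))"
    unfolding eigenvalues_def using t
    by (intro trace_resolvent_eigenvalues[OF ABC_matrix_carrier transpose_ABC_matrix]) auto
  also have "Im \<dots> = (\<Sum>x\<in>#eigenvalues f. Im (1 / (complex_of_real x - \<i> * of_real t)))"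
    by (rule Im_sum_mset)
  also have "\<dots> = (\<Sum>x\<in>#eigenvalues f. t / (x\<^sup>2 + t\<^sup>2))"
    by (simp add: Im_divide)
  finally show ?thesis .
qed

text \<open>Three terms: the semicircle law for the centered matrix, the rank-one shift to the scaled adjacency
  matrix, and the Frobenius perturbation to the ABC-matrix.\<close>

lemma E_eigenvalue_stieltjes:
  fixes t :: real
  assumes t: "t > 0"
  shows "E (\<lambda>f. \<bar>(\<Sum>x\<in>#eigenvalues f. t / (x\<^sup>2 + t\<^sup>2)) / n - semicircle_stieltjes v t\<bar>)
     \<le> (t + v / t) / t * ((2 + 6 / (p * t) + 2 / t) / t\<^sup>2) / sqrt n
        + 1 / (n * t) + sqrt (16 * sqrt n / p) / sqrt n / t\<^sup>2"
proof -
  define Y where "Y f i j = centered f i j + scaling * p" for f i j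
  let ?D = "\<lambda>f. sqrt (\<Sum>i<n. \<Sum>j<n. (ABC f i j - scaling * of_bool (adj f i j))\<^sup>2)"
  define u where "u = semicircle_stieltjes v t"
  have Y: "Y f i j = scaling * of_bool (adj f i j)" if "i < n" "j < n" for f i j
    using that by (auto simp: Y_def centered_def adj_def \<eta>_def algebra_simps)
  have Y_sym: "Y f i j = Y f j i" for f i j by (simp add: Y_def centered_sym)
  define GX GY GA where "GX f = resolvent {..<n} (centered f) t" and "GY f = resolvent {..<n} (Y f) t"
    and "GA f = resolvent {..<n} (ABC f) t" for f
  have GX: "is_resolvent {..<n} (centered f) t (GX f)" for f
    unfolding GX_def by (rule is_resolvent_resolvent[OF finite_lessThan centered_sym t])
  have GY: "is_resolvent {..<n} (Y f) t (GY f)" for f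
    unfolding GY_def by (rule is_resolvent_resolvent[OF finite_lessThan Y_sym t])
  have GA: "is_resolvent {..<n} (ABC f) t (GA f)" for f
    unfolding GA_def by (rule is_resolvent_resolvent[OF finite_lessThan ABC_sym t])
  have pointwise: "\<bar>(\<Sum>x\<in>#eigenvalues f. t / (x\<^sup>2 + t\<^sup>2)) / n - u\<bar>
     \<le> cmod (stieltjes t f - \<i> * of_real u) + 1 / (n * t) + ?D f * (1 / sqrt n / t\<^sup>2)" for f
  proof -
    define TX TY TA where "TX = (\<Sum>i<n. GX f i i)" and "TY = (\<Sum>i<n. GY f i i)" and "TA = (\<Sum>i<n. GA f i i)"
    have "(\<Sum>x\<in>#eigenvalues f. t / (x\<^sup>2 + t\<^sup>2)) / n - u = Im (TA / of_nat n - \<i> * of_real u)"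
      by (simp add: Im_divide_of_nat TA_def GA_def Im_trace_resolvent_ABC[OF t, symmetric] del: Im_sum)
    also have "\<bar>\<dots>\<bar> \<le> cmod (TA / of_nat n - \<i> * of_real u)" by (rule abs_Im_le_cmod)
    also have "TA / of_nat n - \<i> * of_real u = (stieltjes t f - \<i> * of_real u) + (TY - TX) / of_nat n - (TY - TA) / of_nat n"
      by (simp add: stieltjes_def TX_def GX_def diff_divide_distrib)
    also have "cmod \<dots> \<le> cmod (stieltjes t f - \<i> * of_real u) + cmod (TY - TX) / n + cmod (TY - TA) / n"
    proof -
      have "cmod (x + y - z) \<le> cmod x + cmod y + cmod z" for x y z
        by (smt (verit) norm_triangle_ineq norm_triangle_ineq4)
      from this[of "stieltjes t f - \<i> * of_real u" "(TY - TX) / of_nat n" "(TY - TA) / of_nat n"]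
      show ?thesis by (simp only: norm_divide norm_of_nat)
    qed
    also have "cmod (TY - TX) \<le> 1 / t"
      unfolding TX_def TY_def
      by (rule cmod_trace_rank_one_diff[OF finite_lessThan centered_sym t GX]) (use GY in \<open>simp add: Y_def[abs_def]\<close>)
    also have "cmod (TY - TA) \<le> ?D f * sqrt (real (card {..<n})) / t\<^sup>2"
      using cmod_trace_frobenius_diff[OF finite_lessThan Y_sym ABC_sym t GY GA, of f]
      by (simp add: TY_def TA_def Y)
    finally have "\<bar>(\<Sum>x\<in>#eigenvalues f. t / (x\<^sup>2 + t\<^sup>2)) / n - u\<bar>
      \<le> cmod (stieltjes t f - \<i> * of_real u) + 1 / t / n + ?D f * sqrt n / t\<^sup>2 / n"
      by (simp add: divide_right_mono add_mono)
    also have "?D f * sqrt n / t\<^sup>2 / n = ?D f * (1 / sqrt n / t\<^sup>2)"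
    proof -
      have "sqrt n / n = 1 / sqrt n" using n_pos by (simp add: real_div_sqrt field_simps)
      moreover have "?D f * sqrt n / t\<^sup>2 / n = ?D f * (sqrt n / n) / t\<^sup>2" by simp
      ultimately show ?thesis by (simp only: times_divide_eq_right)
    qed
    finally show ?thesis by (simp add: mult.commute)
  qed
  have "E (\<lambda>f. \<bar>(\<Sum>x\<in>#eigenvalues f. t / (x\<^sup>2 + t\<^sup>2)) / n - u\<bar>)
    \<le> E (\<lambda>f. cmod (stieltjes t f - \<i> * of_real u) + 1 / (n * t) + ?D f * (1 / sqrt n / t\<^sup>2))"
    by (rule E_mono, rule pointwise)
  also have "\<dots> = E (\<lambda>f. cmod (stieltjes t f - \<i> * of_real u)) + 1 / (n * t) + E ?D * (1 / sqrt n / t\<^sup>2)"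
    by simp
  also have "\<dots> \<le> (t + v / t) / t * ((2 + 6 / (p * t) + 2 / t) / t\<^sup>2) / sqrt n + 1 / (n * t)
       + sqrt (16 * sqrt n / p) * (1 / sqrt n / t\<^sup>2)"
    unfolding u_def by (intro add_mono mult_right_mono E_stieltjes_convergence[OF t] E_frobenius_diff) auto
  finally show ?thesis by (simp add: u_def)
qed

end

section \<open>Riemann sums for the absolute value and for the semicircle law\<close>

text \<open>For a decreasing \<open>g\<close> every rectangle underestimates the corresponding increment of the antiderivative
  by at most \<open>h\<close> times the drop of \<open>g\<close>. These errors telescope, and the total drop is at most \<open>1\<close>.\<close>

lemma riemann_sum_antimono:
  fixes F g :: "real \<Rightarrow> real" and h :: real
  assumes h: "h > 0" and N: "N > 0"
    and deriv: "\<And>x. x \<ge> 0 \<Longrightarrow> (F has_real_derivative g x) (at x)"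
    and mono: "\<And>x y. 0 \<le> x \<Longrightarrow> x \<le> y \<Longrightarrow> g y \<le> g x"
    and g0: "g 0 \<le> 1" and g: "\<And>x. x \<ge> 0 \<Longrightarrow> 0 \<le> g x"
  shows "\<bar>(F (real N * h) - F 0) - h * (\<Sum>j=1..N. g (real j * h))\<bar> \<le> h"
proof -
  have step: "h * g (real (Suc j) * h) \<le> F (real (Suc j) * h) - F (real j * h)
      \<and> F (real (Suc j) * h) - F (real j * h) \<le> h * g (real j * h)" for j
  proof -
    have "real j * h < real (Suc j) * h" using h by simp
    moreover have nonneg: "0 \<le> real j * h" using h by simp
    ultimately obtain z where z: "real j * h < z" "z < real (Suc j) * h"
      "F (real (Suc j) * h) - F (real j * h) = (real (Suc j) * h - real j * h) * g z"
      using MVT2[of "real j * h" "real (Suc j) * h" F g] deriv by (meson order_trans)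
    have "g (real (Suc j) * h) \<le> g z" "g z \<le> g (real j * h)" using z nonneg by (auto intro!: mono)
    moreover have "F (real (Suc j) * h) - F (real j * h) = h * g z" using z(3) by (simp add: algebra_simps)
    ultimately show ?thesis using h by (simp add: mult_left_mono)
  qed
  have lower: "h * (\<Sum>j=1..m. g (real j * h)) \<le> F (real m * h) - F 0" for m
  proof (induction m)
    case (Suc m)
    thus ?case using step[of m] by (simp add: distrib_left algebra_simps)
  qed simp
  have upper: "F (real m * h) - F 0 \<le> h * (\<Sum>j=1..m. g (real j * h)) + h * (g 0 - g (real m * h))" for m
  proof (induction m)
    case (Suc m)
    thus ?case using step[of m] by (simp add: distrib_left right_diff_distrib)
  qed simp
  have "h * (g 0 - g (real N * h)) \<le> h * 1"
    using h g0 g[of "real N * h"] by (intro mult_left_mono) auto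
  thus ?thesis using lower[of N] upper[of N] by (simp add: abs_le_iff)
qed

text \<open>For \<open>y = \<bar>x\<bar>\<close> the function \<open>y * arctan (t / y)\<close> is an antiderivative in \<open>t\<close> of the summand, and it tends
  to \<open>y * pi / 2\<close>. The term \<open>h\<close> is the discretization error, and the other one is the part of the integral
  beyond \<open>N h\<close>.\<close>

lemma abs_riemann_sum:
  fixes x h :: real
  assumes h: "h > 0" and N: "N > 0"
  shows "\<bar>\<bar>x\<bar> - 2 / pi * h * (\<Sum>j=1..N. x\<^sup>2 / (x\<^sup>2 + (real j * h)\<^sup>2))\<bar> \<le> h + x\<^sup>2 / (real N * h)"
proof (cases "x = 0")
  case True
  thus ?thesis using h by simp
next
  case False
  define y where "y = \<bar>x\<bar>"
  have y: "y > 0" using False by (simp add: y_def)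
  have ysq: "x\<^sup>2 = y\<^sup>2" by (simp add: y_def)
  define T where "T = real N * h"
  have T: "T > 0" using h N by (simp add: T_def)
  let ?g = "\<lambda>t. y\<^sup>2 / (y\<^sup>2 + t\<^sup>2)"
  let ?S = "h * (\<Sum>j=1..N. ?g (real j * h))"
  have "\<bar>(y * arctan (T / y) - y * arctan (0 / y)) - ?S\<bar> \<le> h"
    unfolding T_def
  proof (rule riemann_sum_antimono[OF h N])
    fix t :: real
    have "1 + (t / y)\<^sup>2 = (y\<^sup>2 + t\<^sup>2) / y\<^sup>2" using y by (simp add: power_divide add_divide_distrib)
    hence "y * (inverse (1 + (t / y)\<^sup>2) * (1 / y)) = y\<^sup>2 / (y\<^sup>2 + t\<^sup>2)"
      using y by simp
    moreover have "((\<lambda>t. y * arctan (t / y)) has_real_derivative y * (inverse (1 + (t / y)\<^sup>2) * (1 / y))) (at t)"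
      by (auto intro!: derivative_eq_intros)
    ultimately show "((\<lambda>t. y * arctan (t / y)) has_real_derivative ?g t) (at t)" by simp
  next
    fix s t :: real assume "0 \<le> s" "s \<le> t"
    thus "?g t \<le> ?g s" using y by (intro divide_left_mono add_left_mono power_mono mult_pos_pos add_pos_nonneg) auto
  qed (use y in auto)
  hence S: "\<bar>y * arctan (T / y) - ?S\<bar> \<le> h" by simp
  have "arctan (T / y) = pi / 2 - arctan (y / T)"
    using arctan_inverse[of "T / y"] y T by simp
  moreover have "0 \<le> arctan (y / T)" "arctan (y / T) \<le> y / T"
    using y T by (auto intro: arctan_le_self)
  ultimately have "pi / 2 - y / T \<le> arctan (T / y)" "arctan (T / y) \<le> pi / 2"
    by linarith+
  hence "y * (pi / 2 - y / T) \<le> y * arctan (T / y)" "y * arctan (T / y) \<le> y * (pi / 2)"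
    using y by (auto intro: mult_left_mono simp del: mult_le_cancel_left_pos)
  hence "\<bar>y * (pi / 2) - ?S\<bar> \<le> h + y\<^sup>2 / T"
    using S by (simp add: abs_le_iff power2_eq_square right_diff_distrib)
  hence "2 / pi * \<bar>y * (pi / 2) - ?S\<bar> \<le> 1 * (h + y\<^sup>2 / T)"
    using pi_gt3 T h by (intro mult_mono) auto
  moreover have "y - 2 / pi * h * (\<Sum>j=1..N. ?g (real j * h)) = 2 / pi * (y * (pi / 2) - ?S)"
    by (simp add: right_diff_distrib)
  hence "\<bar>y - 2 / pi * h * (\<Sum>j=1..N. ?g (real j * h))\<bar> = 2 / pi * \<bar>y * (pi / 2) - ?S\<bar>"
    by (simp only: abs_mult) simp
  ultimately show ?thesis unfolding ysq T_def[symmetric] y_def[symmetric] by (simp only: mult_1)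
qed

text \<open>The same for the semicircle law: \<open>4 sqrt v / 3\<close> is the integral of \<open>1 - t u = v u\<^sup>2\<close> over \<open>t > 0\<close>. The
  substitution \<open>t = 1 / u - v u\<close>, the defining equation of \<open>u\<close> solved for \<open>t\<close>, makes the integral elementary
  and gives the antiderivative \<open>- (v u + v\<^sup>2 u\<^sup>3 / 3)\<close>.\<close>

lemma semicircle_riemann_sum:
  fixes v h :: real
  assumes h: "h > 0" and N: "N > 0" and v: "v > 0"
  shows "\<bar>4 * sqrt v / 3 - h * (\<Sum>j=1..N. 1 - real j * h * semicircle_stieltjes v (real j * h))\<bar>
    \<le> h + 4 * v / (3 * (real N * h))"
proof -
  define T where "T = real N * h"
  have T: "T > 0" using h N by (simp add: T_def)
  let ?u = "semicircle_stieltjes v"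
  note u_pos = semicircle_stieltjes_pos[OF v]
  let ?g = "\<lambda>t. v * (?u t)\<^sup>2"
  let ?F = "\<lambda>t. - (v * ?u t + v\<^sup>2 * (?u t)^3 / 3)"
  have g: "?g t = 1 - t * ?u t" for t
    using semicircle_stieltjes_eq[OF v, of t] by simp
  have "\<bar>(?F (real N * h) - ?F 0) - h * (\<Sum>j=1..N. ?g (real j * h))\<bar> \<le> h"
  proof (rule riemann_sum_antimono[OF h N])
    fix t :: real
    define r where "r = sqrt (t\<^sup>2 + 4 * v)"
    have rpos: "t\<^sup>2 + 4 * v > 0" using v by (simp add: add_nonneg_pos)
    hence r: "r > 0" by (simp add: r_def)
    have u: "?u t = (r - t) / (2 * v)" by (simp add: semicircle_stieltjes_def r_def)
    have du: "(?u has_real_derivative (t / r - 1) / (2 * v)) (at t)"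
      unfolding semicircle_stieltjes_def r_def using rpos v
      by (auto intro!: derivative_eq_intros simp: field_simps)
    have "(?F has_real_derivative - (v + v\<^sup>2 * (?u t)\<^sup>2) * u') (at t)" if "(?u has_real_derivative u') (at t)" for u'
      using that by (auto intro!: derivative_eq_intros simp: algebra_simps power2_eq_square)
    from this[OF du]
    have "(?F has_real_derivative - (v + v\<^sup>2 * (?u t)\<^sup>2) * ((t / r - 1) / (2 * v))) (at t)" .
    moreover have "- (v + v\<^sup>2 * (?u t)\<^sup>2) * ((t / r - 1) / (2 * v)) = ?g t"
    proof -
      have "(t / r - 1) / (2 * v) = - ?u t / r" using r v by (simp add: u field_simps)
      moreover have "v + v\<^sup>2 * (?u t)\<^sup>2 = v * ?u t * r"
      proof -
        have "r = 2 * v * ?u t + t" using v by (simp add: u)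
        hence "v * ?u t * r = v * (2 * (v * (?u t)\<^sup>2) + t * ?u t)" by (simp add: power2_eq_square algebra_simps)
        also have "\<dots> = v * (1 + v * (?u t)\<^sup>2)" using g[of t] by simp
        finally show ?thesis by (simp add: power2_eq_square algebra_simps)
      qed
      ultimately show ?thesis using r by (simp add: power2_eq_square)
    qed
    ultimately show "(?F has_real_derivative ?g t) (at t)" by simp
  next
    fix s t :: real assume st: "0 \<le> s" "s \<le> t"
    have "?u t \<le> ?u s"
    proof (rule ccontr)
      \<comment> \<open>If both \<open>t\<close> and \<open>u\<close> grew, so would \<open>v u\<^sup>2 + t u\<close>, which is constant.\<close>
      assume "\<not> ?u t \<le> ?u s"
      hence lt: "?u s < ?u t" by simp
      hence "v * (?u s)\<^sup>2 < v * (?u t)\<^sup>2" using v u_pos[of s] by (simp add: power_strict_mono less_imp_le)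
      moreover have "s * ?u s \<le> t * ?u t" using st lt u_pos[of s] by (intro mult_mono) (auto simp: less_imp_le)
      ultimately show False using g[of s] g[of t] by linarith
    qed
    thus "?g t \<le> ?g s" using v u_pos[of t] by (simp add: power_mono less_imp_le)
  next
    show "?g 0 \<le> 1" using g[of 0] by simp
  qed (use v in auto)
  moreover have "?F 0 = - (4 * sqrt v / 3)"
  proof -
    have u0: "?u 0 = 1 / sqrt v"
      using v by (simp add: semicircle_stieltjes_def real_sqrt_mult real_div_sqrt field_simps)
    have "v * (1 / sqrt v) = sqrt v" using v by (simp add: real_div_sqrt)
    moreover have "v\<^sup>2 * (1 / sqrt v)^3 = sqrt v"
      using v by (simp add: power_divide power2_eq_square power3_eq_cube real_div_sqrt)
    ultimately show ?thesis unfolding u0 by simp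
  qed
  moreover have "\<bar>?F T\<bar> \<le> 4 * v / (3 * T)"
  proof -
    have "0 \<le> ?g T" "0 \<le> T * ?u T" using v T u_pos[of T] by (simp_all add: less_imp_le)
    hence gT: "?g T \<le> 1" "T * ?u T \<le> 1" using g[of T] by linarith+
    have "v\<^sup>2 * (?u T)^3 / 3 = (v * ?u T) * ?g T / 3" by (simp add: power2_eq_square power3_eq_cube)
    also have "\<dots> \<le> (v * ?u T) * 1 / 3"
      using gT v u_pos[of T] by (intro divide_right_mono mult_left_mono) auto
    finally have "v * ?u T + v\<^sup>2 * (?u T)^3 / 3 \<le> 4 / 3 * v * ?u T" by simp
    also have "?u T \<le> 1 / T" using gT T by (simp add: field_simps)
    hence "4 / 3 * v * ?u T \<le> 4 / 3 * v * (1 / T)" using v by (intro mult_left_mono) auto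
    finally have "v * ?u T + v\<^sup>2 * (?u T)^3 / 3 \<le> 4 * v / (3 * T)" by simp
    moreover have "0 \<le> v * ?u T + v\<^sup>2 * (?u T)^3 / 3" using v u_pos[of T] by simp
    ultimately show ?thesis by simp
  qed
  ultimately show ?thesis
    unfolding T_def[symmetric] g by linarith
qed

section \<open>Convergence of the energy\<close>

lemma abs_sum_mset_le:
  fixes g :: "'a \<Rightarrow> real"
  assumes "\<And>x. x \<in># A \<Longrightarrow> \<bar>g x\<bar> \<le> k x"
  shows "\<bar>\<Sum>x\<in>#A. g x\<bar> \<le> (\<Sum>x\<in>#A. k x)"
  using assms
proof (induction A)
  case (add x A)
  have "\<bar>g x\<bar> \<le> k x" "\<bar>\<Sum>x\<in>#A. g x\<bar> \<le> (\<Sum>x\<in>#A. k x)" using add by auto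
  thus ?case by simp
qed simp

lemma sum_mset_sum_swap:
  fixes g :: "'a \<Rightarrow> 'b \<Rightarrow> 'c::comm_monoid_add"
  shows "(\<Sum>x\<in>#A. \<Sum>j\<in>J. g x j) = (\<Sum>j\<in>J. \<Sum>x\<in>#A. g x j)"
  by (induction A) (simp_all add: sum.distrib)

lemma sum_mset_bounded_by_squares:
  fixes A :: "real multiset" and c d :: real
  shows "(\<Sum>x\<in>#A. c + x\<^sup>2 / d) = size A * c + (\<Sum>x\<in>#A. x\<^sup>2) / d"
  by (induction A) (simp_all add: algebra_simps add_divide_distrib)

lemma sum_mset_subtractf:
  fixes g k :: "'a \<Rightarrow> 'b::ab_group_add"
  shows "(\<Sum>x\<in>#A. g x - k x) = (\<Sum>x\<in>#A. g x) - (\<Sum>x\<in>#A. k x)"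
  by (induction A) (simp_all add: algebra_simps)

context gnp
begin

definition energy :: "(nat set \<Rightarrow> bool) \<Rightarrow> real" where
  "energy f = (\<Sum>x\<in>#eigenvalues f. \<bar>x\<bar>)"

text \<open>The deterministic core: comparing both Riemann sums, the energy is controlled by the traces of the
  resolvent at the points \<open>j h\<close>. The tail \<open>5 / (N h)\<close> combines the second moment of the spectrum, at most
  \<open>2\<close>, with the tail of the semicircle integral, at most \<open>3\<close> because \<open>v \<le> 2\<close>.\<close>

lemma energy_approximation:
  assumes h: "h > 0" and N: "N > 0"
  shows "\<bar>energy f / n - 8 * sqrt v / (3 * pi)\<bar> \<le> 2 * h + 5 / (real N * h)
     + h * (\<Sum>j=1..N. real j * h * \<bar>(\<Sum>x\<in>#eigenvalues f. real j * h / (x\<^sup>2 + (real j * h)\<^sup>2)) / n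
          - semicircle_stieltjes v (real j * h)\<bar>)"
proof -
  have v: "v > 0" "v \<le> 2" using p_less_1 p_pos by auto
  define T where "T = real N * h"
  have T: "T > 0" using h N by (simp add: T_def)
  define w where "w t = (\<Sum>x\<in>#eigenvalues f. t / (x\<^sup>2 + t\<^sup>2)) / n" for t :: real
  let ?u = "semicircle_stieltjes v"
  let ?R = "\<lambda>x. 2 / pi * h * (\<Sum>j=1..N. x\<^sup>2 / (x\<^sup>2 + (real j * h)\<^sup>2))"
  have "\<bar>energy f - (\<Sum>x\<in>#eigenvalues f. ?R x)\<bar> = \<bar>\<Sum>x\<in>#eigenvalues f. \<bar>x\<bar> - ?R x\<bar>"
    by (simp only: energy_def sum_mset_subtractf)
  also have "\<dots> \<le> (\<Sum>x\<in>#eigenvalues f. h + x\<^sup>2 / T)"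
    unfolding T_def by (intro abs_sum_mset_le abs_riemann_sum h N)
  also have "\<dots> \<le> n * h + 2 * n / T"
    unfolding sum_mset_bounded_by_squares size_eigenvalues
    using sum_eigenvalues_sq_le[of f] T by (intro add_left_mono divide_right_mono) auto
  finally have "\<bar>energy f - (\<Sum>x\<in>#eigenvalues f. ?R x)\<bar> / n \<le> (n * h + 2 * n / T) / n"
    by (intro divide_right_mono) auto
  hence 1: "\<bar>energy f / n - (\<Sum>x\<in>#eigenvalues f. ?R x) / n\<bar> \<le> h + 2 / T"
  proof -
    have "\<bar>energy f / n - (\<Sum>x\<in>#eigenvalues f. ?R x) / n\<bar> = \<bar>energy f - (\<Sum>x\<in>#eigenvalues f. ?R x)\<bar> / n"
      by (simp only: diff_divide_distrib[symmetric] abs_divide abs_of_nat)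
    moreover have "(n * h + 2 * n / T) / n = h + 2 / T"
      using n_pos by (simp add: add_divide_distrib)
    ultimately show ?thesis using \<open>\<bar>_\<bar> / n \<le> _\<close> by (simp only:)
  qed
  have "(\<Sum>x\<in>#eigenvalues f. ?R x) / n = 2 / pi * (h * (\<Sum>j=1..N. 1 - real j * h * w (real j * h)))"
  proof -
    have rescale: "n - t * W = n * (1 - t * (W / n))" for t W :: real
      using n_pos by (simp add: right_diff_distrib)
    have "(\<Sum>x\<in>#eigenvalues f. x\<^sup>2 / (x\<^sup>2 + t\<^sup>2)) = n * (1 - t * w t)" if t: "t > 0" for t
    proof -
      have "x\<^sup>2 / (x\<^sup>2 + t\<^sup>2) = 1 - t * (t / (x\<^sup>2 + t\<^sup>2))" for x
      proof -
        have "x\<^sup>2 + t\<^sup>2 > 0" using t by (simp add: add_nonneg_pos)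
        hence "(x\<^sup>2 + t\<^sup>2) / (x\<^sup>2 + t\<^sup>2) = 1" by (intro divide_self) linarith
        hence "x\<^sup>2 / (x\<^sup>2 + t\<^sup>2) + t\<^sup>2 / (x\<^sup>2 + t\<^sup>2) = 1" by (simp only: add_divide_distrib)
        thus ?thesis by (simp add: power2_eq_square)
      qed
      hence "(\<Sum>x\<in>#eigenvalues f. x\<^sup>2 / (x\<^sup>2 + t\<^sup>2)) = (\<Sum>x\<in>#eigenvalues f. 1 - t * (t / (x\<^sup>2 + t\<^sup>2)))"
        by (simp only:)
      also have "\<dots> = n - t * (\<Sum>x\<in>#eigenvalues f. t / (x\<^sup>2 + t\<^sup>2))"
        unfolding sum_mset_subtractf sum_mset_distrib_left[symmetric] by (simp add: size_eigenvalues)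
      also have "\<dots> = n * (1 - t * w t)" unfolding w_def
        by (rule rescale)
      finally show ?thesis .
    qed
    moreover have "(\<Sum>x\<in>#eigenvalues f. ?R x) = 2 / pi * h * (\<Sum>j=1..N. \<Sum>x\<in>#eigenvalues f. x\<^sup>2 / (x\<^sup>2 + (real j * h)\<^sup>2))"
      by (simp only: sum_mset_distrib_left[symmetric] sum_mset_sum_swap)
    ultimately have "(\<Sum>x\<in>#eigenvalues f. ?R x) = 2 / pi * h * (\<Sum>j=1..N. n * (1 - real j * h * w (real j * h)))"
      using h by simp
    thus ?thesis using n_pos by (simp add: sum_distrib_left[symmetric])
  qed
  note 2 = this
  have "(\<Sum>j=1..N. 1 - real j * h * w (real j * h)) - (\<Sum>j=1..N. 1 - real j * h * ?u (real j * h))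
     = (\<Sum>j=1..N. real j * h * (?u (real j * h) - w (real j * h)))"
    unfolding sum_subtractf[symmetric] by (simp add: right_diff_distrib)
  hence "\<bar>h * (\<Sum>j=1..N. 1 - real j * h * w (real j * h)) - h * (\<Sum>j=1..N. 1 - real j * h * ?u (real j * h))\<bar>
     = h * \<bar>\<Sum>j=1..N. real j * h * (?u (real j * h) - w (real j * h))\<bar>"
    unfolding right_diff_distrib[of h, symmetric] using h by (simp only: abs_mult abs_of_pos)
  also have "\<dots> \<le> h * (\<Sum>j=1..N. real j * h * \<bar>w (real j * h) - ?u (real j * h)\<bar>)"
    using h by (intro mult_left_mono order_trans[OF sum_abs] sum_mono) (auto simp: abs_mult abs_minus_commute)
  finally have 3: "\<bar>h * (\<Sum>j=1..N. 1 - real j * h * w (real j * h)) - h * (\<Sum>j=1..N. 1 - real j * h * ?u (real j * h))\<bar>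
     \<le> h * (\<Sum>j=1..N. real j * h * \<bar>w (real j * h) - ?u (real j * h)\<bar>)" .
  have 4: "\<bar>4 * sqrt v / 3 - h * (\<Sum>j=1..N. 1 - real j * h * ?u (real j * h))\<bar> \<le> h + 4 * v / (3 * T)"
    unfolding T_def by (rule semicircle_riemann_sum[OF h N v(1)])
  have "\<bar>h * (\<Sum>j=1..N. 1 - real j * h * w (real j * h)) - 4 * sqrt v / 3\<bar>
      \<le> h + 4 * v / (3 * T) + h * (\<Sum>j=1..N. real j * h * \<bar>w (real j * h) - ?u (real j * h)\<bar>)"
    using 3 4 by linarith
  hence "2 / pi * \<bar>h * (\<Sum>j=1..N. 1 - real j * h * w (real j * h)) - 4 * sqrt v / 3\<bar>
      \<le> 1 * (h + 4 * v / (3 * T) + h * (\<Sum>j=1..N. real j * h * \<bar>w (real j * h) - ?u (real j * h)\<bar>))"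
    using pi_gt3 by (intro mult_mono) auto
  moreover have "(\<Sum>x\<in>#eigenvalues f. ?R x) / n - 8 * sqrt v / (3 * pi)
      = 2 / pi * (h * (\<Sum>j=1..N. 1 - real j * h * w (real j * h)) - 4 * sqrt v / 3)"
    unfolding 2 right_diff_distrib by simp
  hence "\<bar>(\<Sum>x\<in>#eigenvalues f. ?R x) / n - 8 * sqrt v / (3 * pi)\<bar>
      = 2 / pi * \<bar>h * (\<Sum>j=1..N. 1 - real j * h * w (real j * h)) - 4 * sqrt v / 3\<bar>"
    by (simp only: abs_mult) simp
  ultimately have "\<bar>energy f / n - 8 * sqrt v / (3 * pi)\<bar> \<le> h + 2 / T + (h + 4 * v / (3 * T)
       + h * (\<Sum>j=1..N. real j * h * \<bar>w (real j * h) - ?u (real j * h)\<bar>))"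
  proof -
    have "\<bar>x - z\<bar> \<le> c + d" if "e \<le> 1 * d" "\<bar>y - z\<bar> = e" "\<bar>x - y\<bar> \<le> c" for x y z c d e :: real
      using that by linarith
    thus ?thesis using 1 \<open>2 / pi * _ \<le> _\<close> \<open>\<bar>_ - 8 * sqrt v / (3 * pi)\<bar> = _\<close> by blast
  qed
  moreover have "4 * v / (3 * T) \<le> 3 / T" using v T by (simp add: field_simps)
  moreover have "5 / T = 2 / T + 3 / T" by (simp flip: add_divide_distrib)
  ultimately show ?thesis unfolding w_def T_def[symmetric] by linarith
qed

end

definition stieltjes_error :: "real \<Rightarrow> real \<Rightarrow> nat \<Rightarrow> real" where
  "stieltjes_error p t n = (t + 2 * (1 - p) / t) / t * ((2 + 6 / (p * t) + 2 / t) / t\<^sup>2) / sqrt n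
        + 1 / (n * t) + sqrt (16 * sqrt n / p) / sqrt n / t\<^sup>2"

lemma stieltjes_error_tendsto_0:
  assumes "p > 0" "t > 0"
  shows "stieltjes_error p t \<longlonglongrightarrow> 0"
proof -
  define c d where "c = (t + 2 * (1 - p) / t) / t * ((2 + 6 / (p * t) + 2 / t) / t\<^sup>2)" and "d = t\<^sup>2"
  have lim: "(\<lambda>n::nat. inverse (sqrt n)) \<longlonglongrightarrow> 0"
    by (intro tendsto_inverse_0_at_top filterlim_compose[OF sqrt_at_top filterlim_real_sequentially])
  have "(\<lambda>n::nat. c / sqrt n) \<longlonglongrightarrow> 0"
    using tendsto_mult_right_zero[OF lim, of c] by (simp add: divide_inverse)
  moreover have "(\<lambda>n::nat. 1 / (n * t)) \<longlonglongrightarrow> 0"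
    using tendsto_mult_right_zero[OF lim_inverse_n, of "1 / t"] by (simp add: field_simps)
  moreover have "(\<lambda>n::nat. sqrt (16 * sqrt n / p) / sqrt n / d) \<longlonglongrightarrow> 0"
  proof -
    have "sqrt (16 * sqrt n / p) / sqrt n = sqrt (16 / p * inverse (sqrt n))" for n :: nat
    proof -
      have "x / (x * x) = inverse x" for x :: real
        by (cases "x = 0") (simp_all add: divide_inverse)
      from this[of "sqrt n"] have "sqrt n / n = inverse (sqrt n)" by simp
      hence "16 * sqrt n / p / n = 16 / p * inverse (sqrt n)"
        by (simp add: divide_inverse)
      thus ?thesis by (simp only: real_sqrt_divide[symmetric])
    qed
    moreover have "(\<lambda>n::nat. sqrt (16 / p * inverse (sqrt n)) / d) \<longlonglongrightarrow> 0"
      using tendsto_divide_zero[OF tendsto_real_sqrt[OF tendsto_mult_right_zero[OF lim, of "16 / p"], unfolded real_sqrt_zero], of d] .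
    ultimately show ?thesis by (simp only:)
  qed
  ultimately show ?thesis
    unfolding stieltjes_error_def c_def[symmetric] unfolding d_def[symmetric] by (intro tendsto_add_zero)
qed

text \<open>First choose the mesh \<open>h\<close>, then the length \<open>N h\<close> of the integration range; only then let \<open>n\<close> grow, so
  that finitely many Stieltjes transforms have to converge.\<close>

lemma E_energy_tendsto:
  fixes p :: real
  assumes p: "0 < p" "p < 1"
  shows "(\<lambda>n. measure_pmf.expectation (gnp_pmf n p) (\<lambda>E. \<bar>matrix_energy (ABC_matrix n E) / n
      - 8 * sqrt (2 * (1 - p)) / (3 * pi)\<bar>)) \<longlonglongrightarrow> 0" (is "?e \<longlonglongrightarrow> 0")
proof (rule LIMSEQ_I)
  fix r :: real assume r: "0 < r"
  \<comment> \<open>The mesh and the tail account for \<open>r / 4\<close> each, and so does the error of the transforms.\<close>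
  define h where "h = r / 8"
  have h: "h > 0" using r by (simp add: h_def)
  obtain N where N: "real N > 20 / (r * h)" using reals_Archimedean2 by blast
  have "20 / (r * h) > 0" using r h by simp
  hence N0: "real N > 0" using N by linarith
  hence tail: "5 / (real N * h) \<le> r / 4" using N r h by (simp add: field_simps)
  let ?b = "\<lambda>n. h * (\<Sum>j=1..N. real j * h * stieltjes_error p (real j * h) n)"
  have "?b \<longlonglongrightarrow> 0"
    using p h by (intro tendsto_mult_right_zero tendsto_null_sum stieltjes_error_tendsto_0) auto
  hence small: "eventually (\<lambda>n. ?b n < r / 4) sequentially"
    by (rule order_tendstoD) (use r in auto)
  have bound: "norm (?e n - 0) \<le> 2 * h + 5 / (real N * h) + ?b n" if n: "n > 0" for n
  proof -
    interpret gnp n p using n p by unfold_locales auto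
    let ?w = "\<lambda>f t. \<bar>(\<Sum>x\<in>#eigenvalues f. t / (x\<^sup>2 + t\<^sup>2)) / n - semicircle_stieltjes (2 * (1 - p)) t\<bar>"
    have "?e n = E (\<lambda>f. \<bar>energy f / n - 8 * sqrt (2 * (1 - p)) / (3 * pi)\<bar>)"
      by (simp add: gnp_pmf_def energy_def eigenvalues_def edges_def matrix_energy_def)
    also have "\<dots> \<le> E (\<lambda>f. 2 * h + 5 / (real N * h) + h * (\<Sum>j=1..N. real j * h * ?w f (real j * h)))"
      using h N0 by (intro E_mono energy_approximation) auto
    also have "\<dots> = 2 * h + 5 / (real N * h) + h * (\<Sum>j=1..N. real j * h * E (\<lambda>f. ?w f (real j * h)))"
      by simp
    also have "\<dots> \<le> 2 * h + 5 / (real N * h) + ?b n"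
      unfolding stieltjes_error_def using h
      by (intro add_left_mono mult_left_mono sum_mono E_eigenvalue_stieltjes) auto
    finally have "?e n \<le> 2 * h + 5 / (real N * h) + ?b n" .
    moreover have "0 \<le> ?e n" by (rule Bochner_Integration.integral_nonneg) auto
    ultimately show ?thesis by simp
  qed
  have "eventually (\<lambda>n. norm (?e n - 0) < r) sequentially"
    using small eventually_gt_at_top[of 0]
  proof eventually_elim
    case (elim n)
    have "2 * h = r / 4" by (simp add: h_def)
    thus ?case using elim(1) bound[OF elim(2)] tail r by linarith
  qed
  thus "\<exists>no. \<forall>n\<ge>no. norm (?e n - 0) < r" by (simp add: eventually_sequentially)
qed

lemma finite_set_gnp_pmf: "finite (set_pmf (gnp_pmf n p))"
  by (rule finite_subset[of _ "Pow (all_edges n)"]) (auto simp: gnp_pmf_def finite_all_edges)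

theorem corollary8:
  fixes p :: real
  assumes "0 < p" and "p < 1"
  shows "\<forall>\<epsilon>>0. (\<lambda>n. measure_pmf.prob (gnp_pmf n p)
    {E. \<bar>matrix_energy (ABC_matrix n E) /
          (8 * sqrt 2 / (3 * pi) * sqrt (1 - p) * real n) - 1\<bar> > \<epsilon>}) \<longlonglongrightarrow> 0"
proof (intro allI impI)
  fix \<epsilon> :: real assume \<epsilon>: "\<epsilon> > 0"
  define L where "L = 8 * sqrt (2 * (1 - p)) / (3 * pi)"
  have L: "L > 0"
    unfolding L_def using assms by (intro divide_pos_pos mult_pos_pos) auto
  have L_eq: "8 * sqrt 2 / (3 * pi) * sqrt (1 - p) = L"
    unfolding L_def real_sqrt_mult by (simp only: times_divide_eq_left mult.assoc)
  let ?X = "\<lambda>n E. \<bar>matrix_energy (ABC_matrix n E) / n - L\<bar>"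
  let ?P = "\<lambda>n. measure_pmf.prob (gnp_pmf n p) {E. \<bar>matrix_energy (ABC_matrix n E) / (L * real n) - 1\<bar> > \<epsilon>}"
  have lim: "(\<lambda>n. measure_pmf.expectation (gnp_pmf n p) (?X n) / (L * \<epsilon>)) \<longlonglongrightarrow> 0"
    using tendsto_divide_zero[OF E_energy_tendsto[OF assms, folded L_def]] .
  have markov: "?P n \<le> measure_pmf.expectation (gnp_pmf n p) (?X n) / (L * \<epsilon>)" if n: "n > 0" for n
  proof -
    have 1: "?P n \<le> measure_pmf.prob (gnp_pmf n p) {E. L * \<epsilon> \<le> ?X n E}"
    proof (rule measure_pmf.finite_measure_mono, rule subsetI)
      fix E assume "E \<in> {E. \<bar>matrix_energy (ABC_matrix n E) / (L * real n) - 1\<bar> > \<epsilon>}"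
      hence "L * \<epsilon> \<le> L * \<bar>matrix_energy (ABC_matrix n E) / (L * real n) - 1\<bar>"
        using L by simp
      also have "\<dots> = \<bar>L * (matrix_energy (ABC_matrix n E) / (L * real n) - 1)\<bar>"
        using L by (simp add: abs_mult)
      also have "L * (matrix_energy (ABC_matrix n E) / (L * real n) - 1) = matrix_energy (ABC_matrix n E) / n - L"
        using L by (simp add: right_diff_distrib)
      finally show "E \<in> {E. L * \<epsilon> \<le> ?X n E}" by simp
    qed simp
    have 2: "measure_pmf.prob (gnp_pmf n p) {E. L * \<epsilon> \<le> ?X n E} \<le> measure_pmf.expectation (gnp_pmf n p) (?X n) / (L * \<epsilon>)"
    proof -
      have "integrable (measure_pmf (gnp_pmf n p)) (?X n)"
        by (rule integrable_measure_pmf_finite[OF finite_set_gnp_pmf])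
      moreover have "0 < L * \<epsilon>" using L \<epsilon> by simp
      ultimately show ?thesis
        using integral_Markov_inequality_measure[of "measure_pmf (gnp_pmf n p)" "?X n" "{}" "L * \<epsilon>"]
        by (simp only: space_measure_pmf sets_measure_pmf) simp
    qed
    from 1 2 show ?thesis by (rule order_trans)
  qed
  have "eventually (\<lambda>n. ?P n \<le> measure_pmf.expectation (gnp_pmf n p) (?X n) / (L * \<epsilon>)) sequentially"
    by (rule eventually_mono[OF eventually_gt_at_top[of 0]]) (rule markov)
  hence "?P \<longlonglongrightarrow> 0"
    by (intro tendsto_sandwich[OF _ _ tendsto_const lim]) auto
  thus "(\<lambda>n. measure_pmf.prob (gnp_pmf n p)
    {E. \<bar>matrix_energy (ABC_matrix n E) /
          (8 * sqrt 2 / (3 * pi) * sqrt (1 - p) * real n) - 1\<bar> > \<epsilon>}) \<longlonglongrightarrow> 0"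
    unfolding L_eq .
qed

end
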